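(* Consider the stochastic ball model (SBM) in $\mathbb{R}^m$ with $m\ge2$, with ball centers $c_1,\dots,c_k\in\mathbb{R}^m$ and probability space $(\mu,B^m_1(0))$, as defined in the context. Assume that $(\mu,B^m_1(0))$ satisfies (a1), (a2), (a3). Assume that $\mu$ has a density function $p(x)$ and assume that, for $x_1,x_2\in B^m_1(0)$ with $\|x_1\|<\|x_2\|$, we have $p(x_1)>p(x_2)$. If for every $i\ne j$ we have $d(c_i,c_j)>2$, then (LP) achieves exact recovery with high probability.
   Context: Notation: $d$ is the Euclidean distance, $\|\cdot\|$ the Euclidean norm, $B^m_r(c)$ the closed ball of radius $r>0$ and center $c$ in $\mathbb{R}^m$, $[k]=\{1,\dots,k\}$. SBM: $(\mu,B^m_1(0))$ is a probability space (i.e. $\mu$ is a Borel probability measure on the closed unit ball). For each $i\in[k]$ one draws $n$ i.i.d. random vectors $v^{(i)}_\ell$, $\ell\in[n]$, according to $\mu$ (draws for different $i$ being independent), and the points from cluster $i$ are $x^{(i)}_\ell:=c_i+v^{(i)}_\ell$, $\ell\in[n]$; these are said to be drawn from the ball $B^m_1(c_i)$. Assumptions: (a1) $\mu$ is invariant under rotations centered in $0$; (a2) every open subset of $B^m_1(0)$ containing $0$ has positive probability measure; (a3) every subset of $B^m_1(0)$ with zero Lebesgue measure has zero probability measure. With $P$ the set of all sampled points, (LP) is \[ \min \sum_{p,q\in P} d(p,q)z_{pq}\ \text{ s.t. }\ \sum_{p\in P}z_{pq}=1\ \forall q\in P;\ z_{pq}\le y_p\ \forall p,q\in P;\ \sum_{p\in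 P}y_p=k;\ y_p,z_{pq}\ge0\ \forall p,q\in P, \] and (IP) is the same program with $y_p,z_{pq}\in\{0,1\}$. (LP) achieves exact recovery if it has a unique optimal solution, this solution is also feasible (thus optimal) to (IP), and it assigns each point to the ball from which it is drawn (exactly one point drawn from each ball has $y_p=1$, and $z_{pq}=1$ only if $p,q$ are drawn from the same ball). An event $A_n$ depending on the parameter $n$ happens with high probability if for every $\delta\in(0,1)$ there exists $N>0$ such that $\mathbb{P}(A_n)>1-\delta$ whenever $n>N$. *)

theory Defs
  imports "HOL-Probability.Probability"
begin

text \<open>Only the values of \<open>y\<close> on \<open>P\<close> and of \<open>z\<close> on \<open>P \<times> P\<close> are decision variables;
  uniqueness of solutions is therefore understood as agreement on \<open>P\<close>.\<close>

definition lp_feasible ::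
  "'a set \<Rightarrow> nat \<Rightarrow> ('a \<Rightarrow> real) \<Rightarrow> ('a \<Rightarrow> 'a \<Rightarrow> real) \<Rightarrow> bool" where
  "lp_feasible P k y z \<longleftrightarrow>
     (\<forall>q\<in>P. (\<Sum>p\<in>P. z p q) = 1) \<and>
     (\<forall>p\<in>P. \<forall>q\<in>P. z p q \<le> y p) \<and>
     (\<Sum>p\<in>P. y p) = real k \<and>
     (\<forall>p\<in>P. y p \<ge> 0) \<and>
     (\<forall>p\<in>P. \<forall>q\<in>P. z p q \<ge> 0)"

definition ip_feasible ::
  "'a set \<Rightarrow> nat \<Rightarrow> ('a \<Rightarrow> real) \<Rightarrow> ('a \<Rightarrow> 'a \<Rightarrow> real) \<Rightarrow> bool" where
  "ip_feasible P k y z \<longleftrightarrow>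
     (\<forall>q\<in>P. (\<Sum>p\<in>P. z p q) = 1) \<and>
     (\<forall>p\<in>P. \<forall>q\<in>P. z p q \<le> y p) \<and>
     (\<Sum>p\<in>P. y p) = real k \<and>
     (\<forall>p\<in>P. y p \<in> {0, 1}) \<and>
     (\<forall>p\<in>P. \<forall>q\<in>P. z p q \<in> {0, 1})"

definition lp_cost :: "'a::metric_space set \<Rightarrow> ('a \<Rightarrow> 'a \<Rightarrow> real) \<Rightarrow> real" where
  "lp_cost P z = (\<Sum>p\<in>P. \<Sum>q\<in>P. dist p q * z p q)"

definition lp_optimal ::
  "'a::metric_space set \<Rightarrow> nat \<Rightarrow> ('a \<Rightarrow> real) \<Rightarrow> ('a \<Rightarrow> 'a \<Rightarrow> real) \<Rightarrow> bool" where
  "lp_optimal P k y z \<longleftrightarrow>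
     lp_feasible P k y z \<and> (\<forall>y' z'. lp_feasible P k y' z' \<longrightarrow> lp_cost P z \<le> lp_cost P z')"

definition lp_unique_optimal ::
  "'a::metric_space set \<Rightarrow> nat \<Rightarrow> ('a \<Rightarrow> real) \<Rightarrow> ('a \<Rightarrow> 'a \<Rightarrow> real) \<Rightarrow> bool" where
  "lp_unique_optimal P k y z \<longleftrightarrow>
     lp_optimal P k y z \<and>
     (\<forall>y' z'. lp_optimal P k y' z' \<longrightarrow>
        (\<forall>p\<in>P. y' p = y p) \<and> (\<forall>p\<in>P. \<forall>q\<in>P. z' p q = z p q))"

text \<open>\<open>C i\<close> is the set of points drawn from the \<open>i\<close>-th ball, \<open>i \<in> {1..k}\<close>.\<close>

definition lp_exact_recovery :: "nat \<Rightarrow> (nat \<Rightarrow> 'a::metric_space set) \<Rightarrow> bool" where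
  "lp_exact_recovery k C \<longleftrightarrow>
     (let P = (\<Union>i\<in>{1..k}. C i) in
      \<exists>y z. lp_unique_optimal P k y z \<and> ip_feasible P k y z \<and>
        (\<forall>i\<in>{1..k}. \<exists>!p. p \<in> C i \<and> y p = 1) \<and>
        (\<forall>p\<in>P. \<forall>q\<in>P. z p q = 1 \<longrightarrow> (\<exists>i\<in>{1..k}. p \<in> C i \<and> q \<in> C i)))"

definition unit_ball_prob :: "'a::euclidean_space measure \<Rightarrow> bool" where
  "unit_ball_prob \<mu> \<longleftrightarrow>
     prob_space \<mu> \<and> sets \<mu> = sets (restrict_space borel (cball 0 1))"

definition rotation_invariant :: "(real ^ 'm) measure \<Rightarrow> bool" where
  "rotation_invariant \<mu> \<longleftrightarrow>
     (\<forall>A :: real ^ 'm ^ 'm. rotation_matrix A \<longrightarrow> distr \<mu> \<mu> (\<lambda>x. A *v x) = \<mu>)"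

definition charges_nhds_zero :: "'a::euclidean_space measure \<Rightarrow> bool" where
  "charges_nhds_zero \<mu> \<longleftrightarrow>
     (\<forall>U. openin (top_of_set (cball 0 1)) U \<and> 0 \<in> U \<longrightarrow> emeasure \<mu> U > 0)"

definition null_on_lebesgue_null :: "'a::euclidean_space measure \<Rightarrow> bool" where
  "null_on_lebesgue_null \<mu> \<longleftrightarrow>
     (\<forall>S\<in>sets \<mu>. emeasure lborel S = 0 \<longrightarrow> emeasure \<mu> S = 0)"

definition has_density_on_unit_ball ::
  "'a::euclidean_space measure \<Rightarrow> ('a \<Rightarrow> real) \<Rightarrow> bool" where
  "has_density_on_unit_ball \<mu> p \<longleftrightarrow>
     p \<in> borel_measurable (restrict_space borel (cball 0 1)) \<and>
     (\<forall>x\<in>cball 0 1. p x \<ge> 0) \<and>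
     \<mu> = density (restrict_space lborel (cball 0 1)) (\<lambda>x. ennreal (p x))"

text \<open>The sample space of the \<open>k * n\<close> independent draws: \<open>\<omega> (i, l)\<close> is the \<open>l\<close>-th
  vector drawn for the \<open>i\<close>-th ball.\<close>

definition sbm :: "'a measure \<Rightarrow> nat \<Rightarrow> nat \<Rightarrow> (nat \<times> nat \<Rightarrow> 'a) measure" where
  "sbm \<mu> k n = (\<Pi>\<^sub>M il\<in>{1..k} \<times> {1..n}. \<mu>)"

definition sbm_cluster ::
  "(nat \<Rightarrow> 'a::real_normed_vector) \<Rightarrow> nat \<Rightarrow> (nat \<times> nat \<Rightarrow> 'a) \<Rightarrow> nat \<Rightarrow> 'a set" where
  "sbm_cluster c n \<omega> i = (\<lambda>l. c i + \<omega> (i, l)) ` {1..n}"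

text \<open>Non-measurable sets have \<open>measure\<close> 0, so the inequality below also entails that
  \<open>{\<omega> \<in> space (M n). Q n \<omega>}\<close> is an event of \<open>M n\<close>.\<close>

definition with_high_probability ::
  "(nat \<Rightarrow> 'b measure) \<Rightarrow> (nat \<Rightarrow> 'b \<Rightarrow> bool) \<Rightarrow> bool" where
  "with_high_probability M Q \<longleftrightarrow>
     (\<forall>\<delta>::real. 0 < \<delta> \<and> \<delta> < 1 \<longrightarrow>
        (\<exists>N>0. \<forall>n>N. measure (M n) {\<omega> \<in> space (M n). Q n \<omega>} > 1 - \<delta>))"

end

theory Submission
  imports Defs
begin

text \<open>A dual solution of (LP) is a family \<open>\<alpha>\<close> with \<open>h p = (\<Sum>q. max 0 (\<alpha> q - dist p q)) \<le> \<xi>\<close> for all \<open>p\<close>.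
  If \<open>h\<close> equals \<open>\<xi>\<close> exactly at the medoids of the clusters, and \<open>\<alpha> q\<close> lies between the distances
  from \<open>q\<close> to its own and to the other medoids, complementary slackness makes the medoid solution the
  unique optimum. We take \<open>\<alpha>\<close> constant on clusters and close to some \<open>a > 1\<close> with \<open>2 * a\<close> less than
  every distance of centers.

  In the limit of many samples \<open>h / n\<close> becomes \<open>H x = (\<Sum>i. E (max 0 (a - dist x (c i + V))))\<close>. Slicing the
  density into its superlevel sets, which are balls of radius \<open>\<rho> \<le> 1\<close> up to their boundaries, reduces
  the bound on \<open>H\<close> to integrals over such balls. Cut the cone at height \<open>a - \<rho>\<close>: the lower parts have
  disjoint supports after moving all centers to \<open>0\<close>, the upper parts live on the disjoint balls
  around the centers. Hence \<open>H x < a - E (norm V)\<close> unless \<open>x\<close> is a center.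

  Concentration on a finite net transfers this strict inequality to the sample away from the
  centers. Near a center the cones are not truncated, so \<open>h\<close> is maximal exactly at the medoid, which is
  almost surely unique because level sets of differences of two distances are null.\<close>

subsection \<open>Dual certificates\<close>

text \<open>Why cut at \<open>a - \<rho>\<close>: this is the height of the cone
  \<open>a - norm v\<close> at the rim of a slice of radius \<rho>. At a center the lower part
  equals \<open>a - \<rho>\<close> on the whole slice and the upper part lies inside the ball around
  that center, so both bounds are attained there. At any other point some of the upper cone sticks
  out of all the balls; this is the source of strictness. Since the limit function reaches its
  maximum at the centers, no uniform gap holds near them, and small balls around the centers need a
  separate exact argument. The margin \<open>a - 1\<close> absorbs all errors there. A single \<xi>
  must be attained at \<open>k\<close> random medoids at once, which a deterministic \<alpha> cannot
  achieve; so \<alpha> may differ between clusters and takes up the fluctuations. A further obstacle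
  is that high probability demands a measurable event, whereas exact recovery quantifies over all
  solutions and speaks of sets of points, in which several draws may coincide. The event is
  therefore decomposed into finitely many cases, each a Borel condition on the distances.\<close>

lemma lp_cost_dual_slack:
  fixes P :: "'a::metric_space set" and A :: "'a \<Rightarrow> real"
  assumes feas: "lp_feasible P k y z"
  shows "lp_cost P z = (\<Sum>q\<in>P. A q) - k * \<xi>
     + (\<Sum>p\<in>P. \<Sum>q\<in>P. max 0 (dist p q - A q) * z p q)
     + (\<Sum>p\<in>P. \<Sum>q\<in>P. max 0 (A q - dist p q) * (y p - z p q))
     + (\<Sum>p\<in>P. y p * (\<xi> - (\<Sum>q\<in>P. max 0 (A q - dist p q))))"
proof -
  have "(\<Sum>p\<in>P. \<Sum>q\<in>P. A q * z p q) = (\<Sum>q\<in>P. A q * (\<Sum>p\<in>P. z p q))"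
    by (subst sum.swap) (simp add: sum_distrib_left)
  also have "\<dots> = (\<Sum>q\<in>P. A q)"
    using feas by (simp add: lp_feasible_def)
  finally have A: "(\<Sum>p\<in>P. \<Sum>q\<in>P. A q * z p q) = (\<Sum>q\<in>P. A q)" .
  have k: "(\<Sum>p\<in>P. y p * \<xi>) = k * \<xi>"
    using feas by (simp add: lp_feasible_def flip: sum_distrib_right)
  \<comment> \<open>\<open>dist p q - A q\<close> is split into its positive and negative part.
    Adding and subtracting \<open>y p * max 0 (A q - dist p q)\<close> then produces the second and
    third slack sum. If \<xi> bounds the cone sums, all three consist of nonnegative terms, so the
    cost exceeds the dual value exactly by the violation of complementary slackness.\<close>
  have "lp_cost P z = (\<Sum>p\<in>P. \<Sum>q\<in>P. A q * z p q + max 0 (dist p q - A q) * z p q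
     - max 0 (A q - dist p q) * z p q)"
    unfolding lp_cost_def
  proof (intro sum.cong refl)
    fix p q
    have "dist p q = A q + max 0 (dist p q - A q) - max 0 (A q - dist p q)"
      by linarith
    then have "dist p q * z p q = (A q + max 0 (dist p q - A q) - max 0 (A q - dist p q)) * z p q"
      by simp
    then show "dist p q * z p q =
        A q * z p q + max 0 (dist p q - A q) * z p q - max 0 (A q - dist p q) * z p q"
      by (simp only: left_diff_distrib distrib_right)
  qed
  moreover have c: "(\<Sum>p\<in>P. \<Sum>q\<in>P. max 0 (A q - dist p q) * y p) =
      (\<Sum>p\<in>P. \<Sum>q\<in>P. y p * max 0 (A q - dist p q))"
    by (simp add: mult.commute)
  ultimately show ?thesis
    by (simp add: sum.distrib sum_subtractf right_diff_distrib sum_distrib_left A k c)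
qed

text \<open>All slack sums vanish for the assignment of every point to its own medoid, so its cost
  equals the dual value. Uniqueness comes from the strict inequalities in \<open>other\<close> and
  \<open>strict\<close>; equality may occur in \<open>own\<close>, because a point is allowed to use
  its own medoid.\<close>

lemma lp_exact_recovery_certificate:
  fixes C :: "nat \<Rightarrow> 'a::metric_space set"
  assumes fin: "\<And>i. i \<in> {1..k} \<Longrightarrow> finite (C i)"
    and disj: "\<And>i j. i \<in> {1..k} \<Longrightarrow> j \<in> {1..k} \<Longrightarrow> i \<noteq> j \<Longrightarrow> C i \<inter> C j = {}"
    and m: "\<And>i. i \<in> {1..k} \<Longrightarrow> m i \<in> C i"
    and own: "\<And>i q. i \<in> {1..k} \<Longrightarrow> q \<in> C i \<Longrightarrow> dist (m i) q \<le> \<alpha> i"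
    and other: "\<And>i j q. i \<in> {1..k} \<Longrightarrow> j \<in> {1..k} \<Longrightarrow> i \<noteq> j \<Longrightarrow> q \<in> C i \<Longrightarrow> \<alpha> i < dist (m j) q"
    and tight: "\<And>i. i \<in> {1..k} \<Longrightarrow> (\<Sum>q\<in>C i. \<alpha> i - dist (m i) q) = \<xi>"
    and strict: "\<And>p. p \<in> (\<Union>i\<in>{1..k}. C i) \<Longrightarrow> p \<notin> m ` {1..k} \<Longrightarrow>
       (\<Sum>i\<in>{1..k}. \<Sum>q\<in>C i. max 0 (\<alpha> i - dist p q)) < \<xi>"
  shows "lp_exact_recovery k C"
proof -
  define P where "P = (\<Union>i\<in>{1..k}. C i)"
  have finP: "finite P"
    using fin by (auto simp: P_def)
  have uniq: "i = j" if "i \<in> {1..k}" "j \<in> {1..k}" "q \<in> C i" "q \<in> C j" for i j q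
    using disj[of i j] that by blast
  define cl where "cl q = (THE i. i \<in> {1..k} \<and> q \<in> C i)" for q
  have cl_eq: "cl q = i" if "i \<in> {1..k}" "q \<in> C i" for i q
    unfolding cl_def using that uniq by blast
  have cl: "cl q \<in> {1..k}" "q \<in> C (cl q)" if "q \<in> P" for q
    using that cl_eq by (force simp: P_def)+
  have mP: "m i \<in> P" if "i \<in> {1..k}" for i
    using m[OF that] that unfolding P_def by blast
  have inj_m: "inj_on m {1..k}"
    using m uniq by (metis inj_onI)
  define A where "A q = \<alpha> (cl q)" for q
  define h where "h p = (\<Sum>q\<in>P. max 0 (A q - dist p q))" for p
  have sumP: "(\<Sum>q\<in>P. f q) = (\<Sum>i\<in>{1..k}. \<Sum>q\<in>C i. f q)" for f :: "'a \<Rightarrow> real"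
    unfolding P_def using fin disj by (intro sum.UNION_disjoint) auto
  have h_alt: "h p = (\<Sum>i\<in>{1..k}. \<Sum>q\<in>C i. max 0 (\<alpha> i - dist p q))" for p
    unfolding h_def sumP A_def by (intro sum.cong refl) (simp add: cl_eq)
  have h_m: "h (m j) = \<xi>" if j: "j \<in> {1..k}" for j
  proof -
    have "h (m j) = (\<Sum>i\<in>{1..k}. if i = j then \<xi> else 0)"
      unfolding h_alt
    proof (intro sum.cong refl)
      fix i assume i: "i \<in> {1..k}"
      have "(\<Sum>q\<in>C i. max 0 (\<alpha> i - dist (m j) q)) =
        (\<Sum>q\<in>C i. if i = j then \<alpha> i - dist (m i) q else 0)"
        using own[OF i] other[OF i j] by (intro sum.cong refl) (force simp: max_def)
      then show "(\<Sum>q\<in>C i. max 0 (\<alpha> i - dist (m j) q)) = (if i = j then \<xi> else 0)"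
        using tight[OF i] by auto
    qed
    then show ?thesis
      using j by simp
  qed
  have h_less: "h p < \<xi>" if "p \<in> P" "p \<notin> m ` {1..k}" for p
    using strict[of p] that by (simp add: h_alt P_def)
  have h_le: "h p \<le> \<xi>" if "p \<in> P" for p
    using h_m h_less[OF that] by fastforce
  define y where "y p = (if p \<in> m ` {1..k} then 1 else 0 :: real)" for p
  define z where "z p q = (if q \<in> P \<and> p = m (cl q) then 1 else 0 :: real)" for p q
  have sum_z: "(\<Sum>p\<in>P. z p q) = 1" if "q \<in> P" for q
    using that finP mP[OF cl(1)[OF that]] by (simp add: z_def)
  have z_le: "z p q \<le> y p" for p q
    using cl(1) by (auto simp: z_def y_def)
  have "(\<Sum>p\<in>P. y p) = (\<Sum>p\<in>m ` {1..k}. 1)"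
    unfolding y_def by (intro sum.mono_neutral_cong_right finP) (use mP in auto)
  then have sum_y: "(\<Sum>p\<in>P. y p) = real k"
    using inj_m by (simp add: card_image)
  have y01: "y p \<in> {0, 1}" and z01: "z p q \<in> {0, 1}" for p q
    by (auto simp: y_def z_def)
  have ip: "ip_feasible P k y z"
    using sum_z z_le sum_y y01 z01 by (simp add: ip_feasible_def)
  have feas: "lp_feasible P k y z"
    using sum_z z_le sum_y insertE[OF y01] insertE[OF z01]
    by (simp add: lp_feasible_def) (metis order_refl singletonD zero_le_one)
  have dual_own: "dist (m (cl q)) q \<le> A q" if "q \<in> P" for q
    using own cl[OF that] by (simp add: A_def)
  have dual_other: "A q < dist (m j) q" if "q \<in> P" "j \<in> {1..k}" "m j \<noteq> m (cl q)" for q j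
    using other[of "cl q" j q] cl[OF that(1)] that by (auto simp: A_def)
  have slack1: "max 0 (dist p q - A q) * z p q = 0" for p q
    using dual_own by (auto simp: z_def)
  have slack2: "max 0 (A q - dist p q) * (y p - z p q) = 0" if "q \<in> P" for p q
    using dual_other[OF that] cl(1)[OF that] that by (fastforce simp: z_def y_def)
  have slack3: "y p * (\<xi> - h p) = 0" for p
    using h_m by (auto simp: y_def)
  have cost: "lp_cost P z = (\<Sum>q\<in>P. A q) - k * \<xi>"
    using lp_cost_dual_slack[OF feas, of A \<xi>]
    by (simp add: slack1 slack2 slack3[unfolded h_def])
  have main: "lp_cost P z \<le> lp_cost P z' \<and> (lp_cost P z' \<le> lp_cost P z \<longrightarrow>
      (\<forall>p\<in>P. y' p = y p) \<and> (\<forall>p\<in>P. \<forall>q\<in>P. z' p q = z p q))"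
    if feas': "lp_feasible P k y' z'" for y' z'
  proof -
    have z'_sum: "\<And>q. q \<in> P \<Longrightarrow> (\<Sum>p\<in>P. z' p q) = 1"
      and z'_le: "\<And>p q. p \<in> P \<Longrightarrow> q \<in> P \<Longrightarrow> z' p q \<le> y' p"
      and y'_sum: "(\<Sum>p\<in>P. y' p) = real k"
      and y'_ge: "\<And>p. p \<in> P \<Longrightarrow> 0 \<le> y' p"
      and z'_ge: "\<And>p q. p \<in> P \<Longrightarrow> q \<in> P \<Longrightarrow> 0 \<le> z' p q"
      using feas' by (auto simp: lp_feasible_def)
    define S1 where "S1 = (\<Sum>p\<in>P. \<Sum>q\<in>P. max 0 (dist p q - A q) * z' p q)"
    define S2 where "S2 = (\<Sum>p\<in>P. \<Sum>q\<in>P. max 0 (A q - dist p q) * (y' p - z' p q))"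
    define S3 where "S3 = (\<Sum>p\<in>P. y' p * (\<xi> - h p))"
    have cost': "lp_cost P z' = lp_cost P z + S1 + S2 + S3"
      using lp_cost_dual_slack[OF feas', of A \<xi>]
      by (simp add: cost S1_def S2_def S3_def h_def)
    have n1: "0 \<le> max 0 (dist p q - A q) * z' p q" if "p \<in> P" "q \<in> P" for p q
      using z'_ge[OF that] by simp
    have n3: "0 \<le> y' p * (\<xi> - h p)" if "p \<in> P" for p
      using y'_ge[OF that] h_le[OF that] by simp
    have S: "0 \<le> S1" "0 \<le> S2" "0 \<le> S3"
      unfolding S1_def S2_def S3_def using n1 n3 z'_le by (auto intro!: sum_nonneg)
    show ?thesis
    proof (intro conjI impI)
      show "lp_cost P z \<le> lp_cost P z'"
        using S cost' by simp
    next
      assume "lp_cost P z' \<le> lp_cost P z"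
      \<comment> \<open>\<open>S3 = 0\<close> forces \<open>y'\<close> to vanish off the medoids,
        and \<open>S1 = 0\<close> keeps \<open>q\<close> from using foreign medoids, which are
        farther away than \<open>A q\<close>. So the own medoid serves \<open>q\<close>
        completely.\<close>
      then have S0: "S1 = 0" "S3 = 0"
        using S cost' by linarith+
      have e1: "max 0 (dist p q - A q) * z' p q = 0" if "p \<in> P" "q \<in> P" for p q
      proof -
        have "(\<Sum>q\<in>P. max 0 (dist p q - A q) * z' p q) = 0"
          using S0(1) finP n1 that unfolding S1_def
          by (subst (asm) sum_nonneg_eq_0_iff) (auto intro!: sum_nonneg)
        then show ?thesis
          using finP n1 that by (subst (asm) sum_nonneg_eq_0_iff) auto
      qed
      have y0: "y' p = 0" if "p \<in> P" "p \<notin> m ` {1..k}" for p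
      proof -
        have "y' p * (\<xi> - h p) = 0"
          using S0(2) finP n3 that unfolding S3_def by (subst (asm) sum_nonneg_eq_0_iff) auto
        then show ?thesis
          using h_less[OF that] by simp
      qed
      have zz: "z' p q = z p q" if pq: "p \<in> P" "q \<in> P" for p q
      proof -
        have off: "z' p' q = 0" if p': "p' \<in> P" "p' \<noteq> m (cl q)" for p'
        proof (cases "p' \<in> m ` {1..k}")
          case True
          then have "A q < dist p' q"
            using dual_other[OF pq(2)] p'(2) by auto
          then show ?thesis
            using e1[OF p'(1) pq(2)] by auto
        next
          case False
          then show ?thesis
            using y0[OF p'(1)] z'_le[OF p'(1) pq(2)] z'_ge[OF p'(1) pq(2)] by simp
        qed
        have "(\<Sum>p\<in>P. z' p q) = (\<Sum>p\<in>P. if p = m (cl q) then z' p q else 0)"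
          using off by (intro sum.cong) auto
        then have "z' (m (cl q)) q = 1"
          using z'_sum[OF pq(2)] finP mP[OF cl(1)[OF pq(2)]] by simp
        then show ?thesis
          using off[OF pq(1)] pq by (auto simp: z_def)
      qed
      \<comment> \<open>A medoid serves itself, which forces \<open>y'\<close> up to 1 there. As the
        total is \<open>k\<close>, no excess is left anywhere.\<close>
      have y1: "1 \<le> y' (m i)" if "i \<in> {1..k}" for i
      proof -
        have "z (m i) (m i) = 1"
          using that m cl_eq mP by (simp add: z_def)
        then show ?thesis
          using z'_le[of "m i" "m i"] zz[of "m i" "m i"] mP[OF that] by simp
      qed
      have nn: "0 \<le> y' p - y p" if "p \<in> P" for p
        using y0[OF that] y1 that by (auto simp: y_def)
      have "(\<Sum>p\<in>P. y' p - y p) = 0"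
        using y'_sum sum_y by (simp add: sum_subtractf)
      then have "\<forall>p\<in>P. y' p - y p = 0"
        using nn finP by (subst (asm) sum_nonneg_eq_0_iff) auto
      then show "\<forall>p\<in>P. y' p = y p" by simp
      show "\<forall>p\<in>P. \<forall>q\<in>P. z' p q = z p q"
        using zz by blast
    qed
  qed
  have "lp_unique_optimal P k y z"
    unfolding lp_unique_optimal_def lp_optimal_def using main feas by blast
  moreover have "\<exists>!p. p \<in> C i \<and> y p = 1" if "i \<in> {1..k}" for i
  proof (rule ex1I[of _ "m i"])
    show "m i \<in> C i \<and> y (m i) = 1"
      using m that by (simp add: y_def)
    show "p = m i" if p: "p \<in> C i \<and> y p = 1" for p
    proof -
      obtain j where "j \<in> {1..k}" "p = m j"
        using p by (auto simp: y_def split: if_splits)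
      then show ?thesis
        using p m[of j] uniq[of i j p] \<open>i \<in> {1..k}\<close> by blast
    qed
  qed
  moreover have "\<exists>i\<in>{1..k}. p \<in> C i \<and> q \<in> C i" if "p \<in> P" "q \<in> P" "z p q = 1" for p q
    using that cl[OF that(2)] m[OF cl(1)[OF that(2)]]
    by (intro bexI[of _ "cl q"]) (auto simp: z_def split: if_splits)
  ultimately show ?thesis
    unfolding lp_exact_recovery_def Let_def P_def[symmetric] using ip by blast
qed

subsection \<open>Sums of cones over separated balls\<close>

lemma nn_integral_lborel_translate:
  fixes f :: "'a::euclidean_space \<Rightarrow> ennreal"
  assumes [measurable]: "f \<in> borel_measurable borel"
  shows "(\<integral>\<^sup>+x. f (b + x) \<partial>lborel) = (\<integral>\<^sup>+x. f x \<partial>lborel)"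
  by (subst (2) lborel_distr_plus[of b, symmetric]) (simp add: nn_integral_distr)

text \<open>This is the geometric source of strictness. If \<open>x\<close> lies in the ball around
  \<open>c j\<close>, walk from \<open>c j\<close> along the ray through \<open>x\<close> until just
  outside that ball; as \<open>x\<close> is not the center itself, the end point is closer than
  \<rho> to \<open>x\<close>.\<close>

lemma ball_not_covered:
  fixes x :: "'a::real_normed_vector" and c :: "'i \<Rightarrow> 'a"
  assumes sep: "\<And>i j. i \<in> I \<Longrightarrow> j \<in> I \<Longrightarrow> i \<noteq> j \<Longrightarrow> d \<le> dist (c i) (c j)"
    and d: "2 * \<rho> < d" and \<rho>: "0 < \<rho>" and x: "x \<notin> c ` I"
  shows "\<exists>w. w \<in> ball x \<rho> \<and> (\<forall>i\<in>I. w \<notin> cball (c i) \<rho>)"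
proof (cases "\<exists>j\<in>I. x \<in> cball (c j) \<rho>")
  case False
  then show ?thesis using \<rho> by (intro exI[of _ x]) auto
next
  case True
  then obtain j where j: "j \<in> I" "dist (c j) x \<le> \<rho>" by auto
  define r where "r = norm (x - c j)"
  have r: "0 < r" "r \<le> \<rho>"
    using x j by (auto simp: r_def dist_norm norm_minus_commute)
  \<comment> \<open>The end point \<open>w\<close> has distance \<open>\<rho> + t\<close> from
    \<open>c j\<close> and \<open>\<rho> + t - r\<close> from \<open>x\<close>. So
    \<open>t < r\<close> keeps it in the ball around \<open>x\<close>, and
    \<open>t < d - 2 * \<rho>\<close> keeps it out of the balls around the other centers.\<close>
  define t where "t = min r (d - 2 * \<rho>) / 2"
  have t: "0 < t" "t < r" "t < d - 2 * \<rho>"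
    using r d by (auto simp: t_def min_def)
  define w where "w = c j + ((\<rho> + t) / r) *\<^sub>R (x - c j)"
  have wc: "dist (c j) w = \<rho> + t"
    using r t by (simp add: w_def dist_norm r_def[symmetric])
  have "w - x = ((\<rho> + t) / r - 1) *\<^sub>R (x - c j)"
    by (simp add: w_def algebra_simps)
  then have "norm (w - x) = \<bar>(\<rho> + t) / r - 1\<bar> * r"
    by (simp add: r_def)
  also have "\<dots> = \<rho> + t - r"
    using r t by (simp add: abs_if field_simps)
  finally have wx: "dist x w = \<rho> + t - r"
    by (simp add: dist_norm norm_minus_commute)
  show ?thesis
  proof (intro exI[of _ w] conjI ballI)
    show "w \<in> ball x \<rho>" using wx t by simp
    fix i assume i: "i \<in> I"
    show "w \<notin> cball (c i) \<rho>"
    proof (cases "i = j")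
      case True
      then show ?thesis using wc t by simp
    next
      case False
      then have "d \<le> dist (c i) w + dist (c j) w"
        using sep[OF i j(1)] dist_triangle2[of "c i" "c j" w] by linarith
      then show ?thesis using wc t by simp
    qed
  qed
qed

text \<open>Split \<open>max 0 (a - t)\<close> at level \<open>a - \<rho>\<close>. The lower parts have disjoint supports as
  functions of \<open>v\<close>, the upper parts become functions of \<open>w = c i + v\<close>, integrated over disjoint
  translates of \<open>L\<close>.\<close>

lemma sum_cone_integral_bound:
  fixes c :: "'i \<Rightarrow> 'a::euclidean_space"
  assumes fin: "finite I"
    and sep: "\<And>i j. i \<in> I \<Longrightarrow> j \<in> I \<Longrightarrow> i \<noteq> j \<Longrightarrow> d \<le> dist (c i) (c j)"
    and d: "2 * a < d" and \<rho>: "0 \<le> \<rho>" "\<rho> \<le> a"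
    and L[measurable]: "L \<in> sets borel" and L1: "ball 0 \<rho> \<subseteq> L" and L2: "L \<subseteq> cball 0 \<rho>"
  shows "(\<integral>\<^sup>+v\<in>L. (\<Sum>i\<in>I. ennreal (max 0 (a - dist x (c i + v)))) \<partial>lborel)
    \<le> (\<integral>\<^sup>+v\<in>L. ennreal (a - norm v) \<partial>lborel)" (is "?lhs \<le> ?rhs")
    and "0 < \<rho> \<Longrightarrow> x \<notin> c ` I \<Longrightarrow>
      (\<integral>\<^sup>+v\<in>L. (\<Sum>i\<in>I. ennreal (max 0 (a - dist x (c i + v)))) \<partial>lborel)
    < (\<integral>\<^sup>+v\<in>L. ennreal (a - norm v) \<partial>lborel)"
proof -
  define low where "low v = (\<Sum>i\<in>I. ennreal (min (max 0 (a - dist x (c i + v))) (a - \<rho>)))" for v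
  define up where "up w = ennreal (max 0 (\<rho> - dist x w))" for w
  define cov where "cov w = (\<Sum>i\<in>I. indicator ((\<lambda>v. c i + v) ` L) w :: ennreal)" for w
  have [measurable]: "low \<in> borel_measurable borel" "up \<in> borel_measurable borel"
    unfolding low_def up_def by measurable
  have trans: "(\<lambda>v. c i + v) ` L = (\<lambda>w. w - c i) -` L \<inter> space borel" for i
    by (force simp: image_iff)
  have [measurable]: "(\<lambda>v. c i + v) ` L \<in> sets borel" for i
    unfolding trans by measurable
  have [measurable]: "cov \<in> borel_measurable borel"
    unfolding cov_def by measurable
  \<comment> \<open>The translates of \<open>L\<close> lie in closed balls of radius \<rho> around
    the centers, which are disjoint because \<open>2 * \<rho> \<le> 2 * a < d\<close>.\<close>
  have cov_le: "cov w \<le> 1" for w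
  proof (cases "\<exists>j\<in>I. w \<in> (\<lambda>v. c j + v) ` L")
    case True
    then obtain j where j: "j \<in> I" "w - c j \<in> L" by (auto simp: trans)
    have "indicator ((\<lambda>v. c i + v) ` L) w = (if i = j then 1 else 0 :: ennreal)" if "i \<in> I" for i
    proof (cases "i = j")
      case False
      have "w - c i \<notin> L"
      proof
        assume "w - c i \<in> L"
        then have "dist (c i) w \<le> \<rho>" "dist (c j) w \<le> \<rho>"
          using L2 j(2) by (auto simp: dist_norm norm_minus_commute)
        then show False
          using sep[OF that j(1) False] dist_triangle2[of "c i" "c j" w] d \<rho> by linarith
      qed
      then show ?thesis using False by (simp add: trans)
    qed (use j in \<open>simp add: trans\<close>)
    then have "cov w = (\<Sum>i\<in>I. if i = j then 1 else 0)"
      unfolding cov_def by (intro sum.cong) auto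
    then show ?thesis using fin j by simp
  next
    case False
    then show ?thesis by (simp add: cov_def)
  qed
  \<comment> \<open>For fixed \<open>v\<close> the points \<open>c i + v\<close> are as far apart as
    the centers, so at most one of them is within distance \<open>a\<close> of \<open>x\<close>; a
    single truncated cone contributes at most \<open>a - \<rho>\<close>.\<close>
  have low_le: "low v \<le> ennreal (a - \<rho>)" for v
  proof (cases "\<exists>j\<in>I. dist x (c j + v) < a")
    case True
    then obtain j where j: "j \<in> I" "dist x (c j + v) < a" by auto
    have "min (max 0 (a - dist x (c i + v))) (a - \<rho>) \<le> (if i = j then a - \<rho> else 0)"
      if "i \<in> I" for i
    proof (cases "i = j")
      case False
      have "d \<le> dist (c i + v) (c j + v)"
        using sep[OF that j(1) False] by simp
      then have "a \<le> dist x (c i + v)"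
        using dist_triangle[of "c i + v" "c j + v" x] j(2) d by (simp add: dist_commute)
      then show ?thesis using False by simp
    qed simp
    then have "low v \<le> (\<Sum>i\<in>I. ennreal (if i = j then a - \<rho> else 0))"
      unfolding low_def by (intro sum_mono ennreal_leI) auto
    also have "\<dots> = (\<Sum>i\<in>I. if i = j then ennreal (a - \<rho>) else 0)"
      by (intro sum.cong) auto
    finally show ?thesis using fin j by simp
  next
    case False
    then have "low v = 0"
      unfolding low_def using \<rho> by (intro sum.neutral ballI) (force simp: max_def)
    then show ?thesis by simp
  qed
  have split: "(\<Sum>i\<in>I. ennreal (max 0 (a - dist x (c i + v)))) = low v + (\<Sum>i\<in>I. up (c i + v))" for v
    unfolding low_def up_def sum.distrib[symmetric]
  proof (intro sum.cong refl)
    fix i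
    have "max 0 (a - dist x (c i + v)) =
      min (max 0 (a - dist x (c i + v))) (a - \<rho>) + max 0 (\<rho> - dist x (c i + v))"
      using \<rho> by (auto simp: max_def min_def)
    then show "ennreal (max 0 (a - dist x (c i + v))) =
      ennreal (min (max 0 (a - dist x (c i + v))) (a - \<rho>)) + ennreal (max 0 (\<rho> - dist x (c i + v)))"
      using \<rho> by (subst ennreal_plus[symmetric]) auto
  qed
  have up_int: "(\<integral>\<^sup>+v\<in>L. (\<Sum>i\<in>I. up (c i + v)) \<partial>lborel) = (\<integral>\<^sup>+w. up w * cov w \<partial>lborel)"
  proof -
    have "(\<integral>\<^sup>+v\<in>L. (\<Sum>i\<in>I. up (c i + v)) \<partial>lborel) =
      (\<Sum>i\<in>I. \<integral>\<^sup>+v. up (c i + v) * indicator ((\<lambda>v. c i + v) ` L) (c i + v) \<partial>lborel)"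
      by (subst nn_integral_sum[symmetric]) (auto simp: sum_distrib_right indicator_def inj_image_mem_iff intro!: nn_integral_cong)
    also have "\<dots> = (\<Sum>i\<in>I. \<integral>\<^sup>+w. up w * indicator ((\<lambda>v. c i + v) ` L) w \<partial>lborel)"
      by (intro sum.cong refl nn_integral_lborel_translate) measurable
    also have "\<dots> = (\<integral>\<^sup>+w. up w * cov w \<partial>lborel)"
      by (subst nn_integral_sum[symmetric]) (auto simp: cov_def sum_distrib_left)
    finally show ?thesis .
  qed
  \<comment> \<open>A cone of radius \<rho> has the same integral wherever its apex lies. Moved to 0
    it is supported in \<open>ball 0 \<rho>\<close>, hence in \<open>L\<close>; this is what the
    inclusion \<open>L1\<close> provides.\<close>
  have up_center: "(\<integral>\<^sup>+w. up w \<partial>lborel) = (\<integral>\<^sup>+v\<in>L. ennreal (\<rho> - norm v) \<partial>lborel)"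
  proof -
    have "(\<integral>\<^sup>+w. up w \<partial>lborel) = (\<integral>\<^sup>+v. up (x + v) \<partial>lborel)"
      by (rule nn_integral_lborel_translate[symmetric]) measurable
    also have "\<dots> = (\<integral>\<^sup>+v\<in>L. ennreal (\<rho> - norm v) \<partial>lborel)"
    proof (intro nn_integral_cong)
      fix v
      show "up (x + v) = ennreal (\<rho> - norm v) * indicator L v"
      proof (cases "norm v < \<rho>")
        case True
        then have "v \<in> L" using L1 by (auto simp: subset_iff)
        then show ?thesis using True by (simp add: up_def dist_norm)
      next
        case False
        then show ?thesis by (simp add: up_def dist_norm ennreal_neg)
      qed
    qed
    finally show ?thesis .
  qed
  have finL: "emeasure lborel L < \<infinity>"
    using L2 by (intro emeasure_bounded_finite bounded_subset[OF bounded_cball L2])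
  have lhs: "?lhs = (\<integral>\<^sup>+v\<in>L. low v \<partial>lborel) + (\<integral>\<^sup>+w. up w * cov w \<partial>lborel)"
    unfolding split up_int[symmetric] by (subst nn_integral_add[symmetric]) (auto simp: distrib_right)
  have rhs: "?rhs = (\<integral>\<^sup>+v\<in>L. ennreal (a - \<rho>) \<partial>lborel) + (\<integral>\<^sup>+w. up w \<partial>lborel)"
    unfolding up_center
  proof (subst nn_integral_add[symmetric])
    have "ennreal (a - norm v) = ennreal (a - \<rho>) + ennreal (\<rho> - norm v)" if "v \<in> L" for v
      using that L2 \<rho> by (subst ennreal_plus[symmetric]) (auto simp: subset_iff)
    then show "?rhs = (\<integral>\<^sup>+v. ennreal (a - \<rho>) * indicator L v + ennreal (\<rho> - norm v) * indicator L v \<partial>lborel)"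
      by (intro nn_integral_cong) (auto simp: indicator_def)
  qed auto
  have le1: "(\<integral>\<^sup>+v\<in>L. low v \<partial>lborel) \<le> (\<integral>\<^sup>+v\<in>L. ennreal (a - \<rho>) \<partial>lborel)"
    using low_le by (intro nn_integral_mono mult_right_mono) auto
  have le2: "up w * cov w \<le> up w" for w
    using mult_left_mono[OF cov_le, of "up w" w] by simp
  show "?lhs \<le> ?rhs"
    unfolding lhs rhs by (intro add_mono le1 nn_integral_mono le2)
  show "?lhs < ?rhs" if pos: "0 < \<rho>" and x: "x \<notin> c ` I"
  proof -
    obtain w0 where w0: "w0 \<in> ball x \<rho>" "\<And>i. i \<in> I \<Longrightarrow> w0 \<notin> cball (c i) \<rho>"
      using ball_not_covered[OF sep _ pos x] d \<rho> by auto
    \<comment> \<open>On this nonempty open set \<open>up\<close> is positive while no translate of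
      \<open>L\<close> is met, so the mass of \<open>up\<close> on \<open>U\<close> is lost.\<close>
    define U where "U = ball x \<rho> - (\<Union>i\<in>I. cball (c i) \<rho>)"
    have U: "open U" "U \<noteq> {}"
      using w0 fin by (auto simp: U_def intro!: open_Diff closed_UN)
    have U_up: "\<not> up w \<le> up w * cov w" if "w \<in> U" for w
    proof -
      have "w \<notin> (\<lambda>v. c i + v) ` L" if "i \<in> I" for i
      proof
        assume "w \<in> (\<lambda>v. c i + v) ` L"
        then have "dist (c i) w \<le> \<rho>"
          using L2 by (auto simp: dist_norm)
        then show False
          using \<open>w \<in> U\<close> that by (auto simp: U_def)
      qed
      then have "cov w = 0" by (simp add: cov_def)
      moreover have "0 < up w" using that by (simp add: U_def up_def)
      ultimately show ?thesis by simp
    qed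
    have nae: "\<not> (AE w in lborel. up w \<le> up w * cov w)"
    proof
      assume "AE w in lborel. up w \<le> up w * cov w"
      then have "AE w in lborel. w \<notin> U"
        by (rule eventually_mono) (use U_up in blast)
      then have "U \<in> null_sets lborel"
        using U(1) by (subst AE_iff_null_sets) auto
      then have "negligible U"
        by (simp add: negligible_iff_null_sets null_sets_completionI)
      then show False
        using U open_not_negligible by blast
    qed
    \<comment> \<open>In \<open>ennreal\<close>, a strict comparison of integrals and the
      cancellation of a common summand both need finiteness.\<close>
    have fin_up: "(\<integral>\<^sup>+w. up w \<partial>lborel) < \<infinity>"
    proof -
      have "(\<integral>\<^sup>+w. up w \<partial>lborel) \<le> (\<integral>\<^sup>+w\<in>L. ennreal \<rho> \<partial>lborel)"
        unfolding up_center by (intro nn_integral_mono mult_right_mono ennreal_leI) auto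
      also have "\<dots> < \<infinity>"
        using finL by (simp add: nn_integral_cmult ennreal_mult_less_top)
      finally show ?thesis .
    qed
    have "(\<integral>\<^sup>+w. up w * cov w \<partial>lborel) \<le> (\<integral>\<^sup>+w. up w \<partial>lborel)"
      by (intro nn_integral_mono le2)
    then have "(\<integral>\<^sup>+w. up w * cov w \<partial>lborel) \<noteq> \<infinity>"
      using fin_up by auto
    then have less: "(\<integral>\<^sup>+w. up w * cov w \<partial>lborel) < (\<integral>\<^sup>+w. up w \<partial>lborel)"
      using nae le2 by (intro nn_integral_less) auto
    have "(\<integral>\<^sup>+v\<in>L. ennreal (a - \<rho>) \<partial>lborel) < \<infinity>"
      using finL by (simp add: nn_integral_cmult ennreal_mult_less_top)
    then have "(\<integral>\<^sup>+v\<in>L. low v \<partial>lborel) < \<infinity>"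
      using le1 by auto
    then have "?lhs < (\<integral>\<^sup>+v\<in>L. low v \<partial>lborel) + (\<integral>\<^sup>+w. up w \<partial>lborel)"
      unfolding lhs using less by (simp add: ennreal_add_left_cancel_less)
    also have "\<dots> \<le> ?rhs"
      unfolding rhs by (intro add_mono le1 order_refl)
    finally show ?thesis .
  qed
qed

section \<open>Superlevel sets of the density\<close>

lemma downward_closed_between_balls:
  fixes L :: "'a::real_normed_vector set"
  assumes bdd: "L \<subseteq> cball 0 r" and r: "0 \<le> r"
    and down: "\<And>v w. v \<in> L \<Longrightarrow> norm w < norm v \<Longrightarrow> w \<in> L"
  obtains \<rho> where "0 \<le> \<rho>" "\<rho> \<le> r" "ball 0 \<rho> \<subseteq> L" "L \<subseteq> cball 0 \<rho>"
proof (cases "L = {}")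
  case True
  then show ?thesis using that[of 0] r by auto
next
  case False
  \<comment> \<open>Points of equal norm are not compared by \<open>down\<close>, so
    \<open>L\<close> may contain an arbitrary part of the sphere of radius \<rho>. Hence the
    enclosure between the open and the closed ball.\<close>
  define \<rho> where "\<rho> = (SUP v\<in>L. norm v)"
  have bdd': "bdd_above (norm ` L)"
    using bdd by (intro bdd_aboveI[of _ r]) auto
  have up: "norm v \<le> \<rho>" if "v \<in> L" for v
    unfolding \<rho>_def using that bdd' by (rule cSUP_upper)
  have "\<rho> \<le> r"
    unfolding \<rho>_def using False bdd by (intro cSUP_least) auto
  moreover have "0 \<le> \<rho>"
    using False up norm_ge_zero order_trans by blast
  moreover have "ball 0 \<rho> \<subseteq> L"
  proof
    fix w :: 'a assume "w \<in> ball 0 \<rho>"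
    then have "norm w < \<rho>" by simp
    then obtain v where "v \<in> L" "norm w < norm v"
      unfolding \<rho>_def using less_cSUP_iff[OF False bdd'] by auto
    then show "w \<in> L" using down by blast
  qed
  moreover have "L \<subseteq> cball 0 \<rho>" using up by auto
  ultimately show ?thesis using that by blast
qed

text \<open>\<open>ennreal (f v)\<close> is the length of the interval \<open>{0..<f v}\<close>;
  exchange the two integrations by Tonelli's theorem.\<close>

lemma nn_integral_layer_cake_density:
  fixes f :: "'a::euclidean_space \<Rightarrow> real" and g :: "'a \<Rightarrow> ennreal"
  assumes [measurable]: "f \<in> borel_measurable borel" "g \<in> borel_measurable borel"
  shows "(\<integral>\<^sup>+v. g v * ennreal (f v) \<partial>lborel) =
    (\<integral>\<^sup>+s. (\<integral>\<^sup>+v\<in>{v. s < f v}. g v \<partial>lborel) * indicator {0..} s \<partial>lborel)"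
proof -
  have "(\<integral>\<^sup>+v. g v * ennreal (f v) \<partial>lborel) =
    (\<integral>\<^sup>+v. (\<integral>\<^sup>+s. g v * indicator {v. s < f v} v * indicator {0..} s \<partial>lborel) \<partial>lborel)"
  proof (intro nn_integral_cong)
    fix v
    have "(\<integral>\<^sup>+s. g v * indicator {v. s < f v} v * indicator {0..} s \<partial>lborel) =
      (\<integral>\<^sup>+s. g v * indicator {0..<f v} s \<partial>lborel)"
      by (intro nn_integral_cong) (auto simp: indicator_def)
    also have "\<dots> = g v * emeasure lborel {0..<f v}"
      by (simp add: nn_integral_cmult)
    also have "emeasure lborel {0..<f v} = ennreal (f v)"
      by (cases "0 \<le> f v") (auto simp: ennreal_neg)
    finally show "g v * ennreal (f v) =
      (\<integral>\<^sup>+s. g v * indicator {v. s < f v} v * indicator {0..} s \<partial>lborel)" by simp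
  qed
  also have "\<dots> = (\<integral>\<^sup>+s. (\<integral>\<^sup>+v. g v * indicator {v. s < f v} v * indicator {0..} s \<partial>lborel) \<partial>lborel)"
    by (rule lborel_pair.Fubini') measurable
  also have "\<dots> = (\<integral>\<^sup>+s. (\<integral>\<^sup>+v\<in>{v. s < f v}. g v \<partial>lborel) * indicator {0..} s \<partial>lborel)"
    by (intro nn_integral_cong nn_integral_multc) measurable
  finally show ?thesis .
qed

lemma sum_cone_expectation_less:
  fixes \<mu> :: "'a::euclidean_space measure" and c :: "'i \<Rightarrow> 'a"
  assumes \<mu>: "unit_ball_prob \<mu>" and dens: "has_density_on_unit_ball \<mu> p"
    and decr: "\<And>x1 x2. x1 \<in> cball 0 1 \<Longrightarrow> x2 \<in> cball 0 1 \<Longrightarrow> norm x1 < norm x2 \<Longrightarrow> p x1 > p x2"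
    and fin: "finite I"
    and sep: "\<And>i j. i \<in> I \<Longrightarrow> j \<in> I \<Longrightarrow> i \<noteq> j \<Longrightarrow> d \<le> dist (c i) (c j)"
    and d: "2 * a < d" and a: "1 \<le> a" and x: "x \<notin> c ` I"
  shows "(\<integral>\<^sup>+v. (\<Sum>i\<in>I. ennreal (max 0 (a - dist x (c i + v)))) \<partial>\<mu>)
    < (\<integral>\<^sup>+v. ennreal (a - norm v) \<partial>\<mu>)"
proof -
  interpret prob_space \<mu> using \<mu> by (simp add: unit_ball_prob_def)
  \<comment> \<open>Extension by zero confines the superlevel sets at levels
    \<open>s \<ge> 0\<close> to the unit ball, so that their radius is at most
    \<open>1 \<le> a\<close>.\<close>
  define f where "f v = (if v \<in> cball 0 1 then p v else 0)" for v
  have [measurable]: "f \<in> borel_measurable borel"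
  proof -
    have "(\<lambda>v. indicator (cball 0 1) v *\<^sub>R p v) \<in> borel_measurable borel"
      using dens unfolding has_density_on_unit_ball_def
      by (subst borel_measurable_restrict_space_iff[symmetric]) auto
    also have "(\<lambda>v. indicator (cball 0 1) v *\<^sub>R p v) = f"
      by (auto simp: f_def indicator_def)
    finally show ?thesis .
  qed
  have f0: "0 \<le> f v" for v
    using dens by (auto simp: f_def has_density_on_unit_ball_def)
  have \<mu>_int: "(\<integral>\<^sup>+v. g v \<partial>\<mu>) = (\<integral>\<^sup>+v. g v * ennreal (f v) \<partial>lborel)"
    if [measurable]: "g \<in> borel_measurable borel" for g :: "'a \<Rightarrow> ennreal"
  proof -
    have \<mu>_eq: "\<mu> = density (restrict_space lborel (cball 0 1)) (\<lambda>x. ennreal (p x))"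
      and p_meas: "p \<in> borel_measurable (restrict_space borel (cball 0 1))"
      using dens by (auto simp: has_density_on_unit_ball_def)
    have [measurable]: "p \<in> borel_measurable (restrict_space lborel (cball 0 1))"
      using p_meas by (simp cong: measurable_cong_sets add: sets_restrict_space)
    have [measurable]: "g \<in> borel_measurable (restrict_space lborel (cball 0 1))"
      by (intro measurable_restrict_space1) simp
    have "(\<integral>\<^sup>+v. g v \<partial>\<mu>) = (\<integral>\<^sup>+v. ennreal (p v) * g v \<partial>restrict_space lborel (cball 0 1))"
      unfolding \<mu>_eq by (rule nn_integral_density) measurable
    also have "\<dots> = (\<integral>\<^sup>+v\<in>cball 0 1. ennreal (p v) * g v \<partial>lborel)"
      by (rule nn_integral_restrict_space) simp
    also have "\<dots> = (\<integral>\<^sup>+v. g v * ennreal (f v) \<partial>lborel)"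
      by (intro nn_integral_cong) (auto simp: f_def indicator_def mult.commute)
    finally show ?thesis .
  qed
  define g where "g v = (\<Sum>i\<in>I. ennreal (max 0 (a - dist x (c i + v))))" for v
  define g0 where "g0 v = ennreal (a - norm v)" for v :: 'a
  have [measurable]: "g \<in> borel_measurable borel" "g0 \<in> borel_measurable borel"
    unfolding g_def g0_def by measurable
  define G where "G s = (\<integral>\<^sup>+v\<in>{v. s < f v}. g v \<partial>lborel) * indicator {0..} s" for s
  define G0 where "G0 s = (\<integral>\<^sup>+v\<in>{v. s < f v}. g0 v \<partial>lborel) * indicator {0..} s" for s
  have [measurable]: "G \<in> borel_measurable borel" "G0 \<in> borel_measurable borel"
    unfolding G_def G0_def by measurable
  have level: "\<exists>\<rho>. 0 \<le> \<rho> \<and> \<rho> \<le> a \<and> ball 0 \<rho> \<subseteq> {v. s < f v} \<and> {v. s < f v} \<subseteq> cball 0 \<rho>"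
    if s: "0 \<le> s" for s
  proof -
    have sub: "{v. s < f v} \<subseteq> cball 0 1"
      using s by (auto simp: f_def split: if_splits)
    have down: "w \<in> {v. s < f v}" if "v \<in> {v. s < f v}" "norm w < norm v" for v w
    proof -
      have "v \<in> cball 0 1" using sub that by blast
      then have "w \<in> cball 0 1" "v \<in> cball 0 1" using that by auto
      then show ?thesis using decr[of w v] that by (simp add: f_def)
    qed
    obtain \<rho> where "0 \<le> \<rho>" "\<rho> \<le> 1" "ball 0 \<rho> \<subseteq> {v. s < f v}" "{v. s < f v} \<subseteq> cball 0 \<rho>"
      by (rule downward_closed_between_balls[OF sub zero_le_one down])
    then show ?thesis using a by (intro exI[of _ \<rho>] conjI) simp_all
  qed
  have le: "G s \<le> G0 s" for s
  proof (cases "0 \<le> s")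
    case True
    then obtain \<rho> where "0 \<le> \<rho>" "\<rho> \<le> a" "ball 0 \<rho> \<subseteq> {v. s < f v}" "{v. s < f v} \<subseteq> cball 0 \<rho>"
      using level by blast
    then show ?thesis
      unfolding G_def G0_def g_def g0_def
      by (intro mult_right_mono sum_cone_integral_bound(1)[OF fin sep d]) auto
  qed (simp add: G_def G0_def)
  \<comment> \<open>Strictness requires slices of positive radius for a set of levels of positive
    length. A point of norm 1/2 has larger density than a point on the unit sphere, so
    \<open>f e > 0\<close>, and each slice at a level below \<open>f e\<close> contains
    \<open>e\<close> and has radius at least 1/2.\<close>
  obtain e :: 'a where e: "norm e = 1/2"
    using vector_choose_size[of "1/2 :: real"] by auto
  obtain e' :: 'a where e': "norm e' = 1"
    using vector_choose_size[of "1 :: real"] by auto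
  have fe: "0 < f e"
    using decr[of e e'] f0[of e'] e e' by (simp add: f_def)
  have less: "G s < G0 s" if s: "s \<in> {0<..<f e}" for s
  proof -
    obtain \<rho> where \<rho>: "0 \<le> \<rho>" "\<rho> \<le> a" "ball 0 \<rho> \<subseteq> {v. s < f v}" "{v. s < f v} \<subseteq> cball 0 \<rho>"
      using level[of s] s by auto
    then have "e \<in> cball 0 \<rho>" using s by auto
    then have "0 < \<rho>" using e by auto
    have [measurable]: "{v. s < f v} \<in> sets borel" by measurable
    show ?thesis
      using sum_cone_integral_bound(2)[OF fin sep d \<rho>(1,2) _ \<rho>(3,4) \<open>0 < \<rho>\<close> x] s
      by (simp add: G_def G0_def g_def g0_def)
  qed
  have intG: "(\<integral>\<^sup>+v. g v \<partial>\<mu>) = (\<integral>\<^sup>+s. G s \<partial>lborel)"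
    "(\<integral>\<^sup>+v. g0 v \<partial>\<mu>) = (\<integral>\<^sup>+s. G0 s \<partial>lborel)"
    unfolding G_def G0_def by (simp_all add: \<mu>_int nn_integral_layer_cake_density)
  have "(\<integral>\<^sup>+v. g0 v \<partial>\<mu>) \<le> (\<integral>\<^sup>+v. ennreal a \<partial>\<mu>)"
    unfolding g0_def by (intro nn_integral_mono ennreal_leI) auto
  also have "\<dots> < \<infinity>"
    by (simp add: emeasure_space_1)
  finally have fin0: "(\<integral>\<^sup>+s. G0 s \<partial>lborel) < \<infinity>"
    by (simp add: intG)
  have "(\<integral>\<^sup>+s. G s \<partial>lborel) \<le> (\<integral>\<^sup>+s. G0 s \<partial>lborel)"
    by (intro nn_integral_mono le)
  then have "(\<integral>\<^sup>+s. G s \<partial>lborel) \<noteq> \<infinity>"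
    using fin0 by auto
  moreover have "\<not> (AE s in lborel. G0 s \<le> G s)"
  proof
    assume "AE s in lborel. G0 s \<le> G s"
    then have "AE s in lborel. s \<notin> {0<..<f e}"
      by (rule eventually_mono) (use less leD in blast)
    then have "{0<..<f e} \<in> null_sets lborel"
      by (subst AE_iff_null_sets) auto
    then show False
      using fe by (auto simp: null_sets_def)
  qed
  ultimately have "(\<integral>\<^sup>+s. G s \<partial>lborel) < (\<integral>\<^sup>+s. G0 s \<partial>lborel)"
    using le by (intro nn_integral_less) auto
  then show ?thesis
    unfolding intG[symmetric] g_def g0_def .
qed

subsection \<open>Uniqueness of medoids\<close>

lemma space_unit_ball_prob: "unit_ball_prob \<mu> \<Longrightarrow> space \<mu> = cball 0 1"
  using sets_eq_imp_space_eq[of \<mu> "restrict_space borel (cball 0 1)"]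
  by (simp add: unit_ball_prob_def space_restrict_space)

lemma measurable_unit_ball_prob:
  "unit_ball_prob \<mu> \<Longrightarrow> g \<in> measurable borel N \<Longrightarrow> g \<in> measurable \<mu> N"
  unfolding unit_ball_prob_def
  by (subst measurable_cong_sets[OF _ refl, of _ "restrict_space borel (cball 0 1)"])
    (auto intro: measurable_restrict_space1)

text \<open>The translates of \<open>S\<close> by \<open>u / Suc n\<close> are pairwise disjoint and stay in a bounded region.\<close>

lemma null_set_of_disjoint_translates:
  fixes S :: "'a::euclidean_space set"
  assumes S[measurable]: "S \<in> sets borel" and bdd: "bounded S"
    and inj: "\<And>x t. x \<in> S \<Longrightarrow> 0 < t \<Longrightarrow> x + t *\<^sub>R u \<notin> S"
  shows "emeasure lborel S = 0"
proof -
  define T where "T n = (\<lambda>x. inverse (real (Suc n)) *\<^sub>R u + x) ` S" for n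
  have T_vimage: "T n = (\<lambda>x. x - inverse (real (Suc n)) *\<^sub>R u) -` S \<inter> space borel" for n
    by (force simp: T_def image_iff)
  have T_meas[measurable]: "T n \<in> sets borel" for n
    unfolding T_vimage by measurable
  have T_emeasure: "emeasure lborel (T n) = emeasure lborel S" for n
  proof -
    have "emeasure lborel S = emeasure (distr lborel borel ((+) (- (inverse (real (Suc n)) *\<^sub>R u)))) S"
      by (simp add: lborel_distr_plus)
    also have "\<dots> = emeasure lborel (T n)"
      by (subst emeasure_distr) (auto simp: T_vimage intro!: arg_cong[where f = "emeasure lborel"])
    finally show ?thesis by simp
  qed
  have disj: "disjoint_family T"
  proof (unfold disjoint_family_on_def, intro ballI impI)
    have *: "T i \<inter> T j = {}" if "i < j" for i j
    proof (rule ccontr)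
      define s where "s = inverse (real (Suc i)) - inverse (real (Suc j))"
      assume "T i \<inter> T j \<noteq> {}"
      then obtain x y where xy: "x \<in> S" "y \<in> S"
        "inverse (real (Suc i)) *\<^sub>R u + x = inverse (real (Suc j)) *\<^sub>R u + y"
        by (auto simp: T_def)
      then have "y = x + s *\<^sub>R u"
        by (simp add: s_def algebra_simps)
      moreover have "0 < s"
        using that by (simp add: s_def less_imp_inverse_less)
      ultimately show False
        using inj xy by blast
    qed
    fix i j :: nat assume "i \<noteq> j"
    then show "T i \<inter> T j = {}"
      using *[of i j] *[of j i] by (cases i j rule: linorder_cases) auto
  qed
  obtain B where B: "\<And>x. x \<in> S \<Longrightarrow> norm x \<le> B"
    using bdd by (auto simp: bounded_iff)
  have "T n \<subseteq> cball 0 (norm u + B)" for n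
  proof
    fix x assume "x \<in> T n"
    then obtain y where y: "y \<in> S" "x = inverse (real (Suc n)) *\<^sub>R u + y"
      by (auto simp: T_def)
    have "norm (inverse (real (Suc n)) *\<^sub>R u) \<le> norm u"
      by (simp add: divide_simps mult_le_cancel_left1)
    then show "x \<in> cball 0 (norm u + B)"
      using norm_triangle_ineq[of "inverse (real (Suc n)) *\<^sub>R u" y] B[OF y(1)] y(2) by auto
  qed
  then have "emeasure lborel (\<Union>n. T n) \<le> emeasure lborel (cball 0 (norm u + B) :: 'a set)"
    by (intro emeasure_mono) auto
  also have "\<dots> < \<infinity>"
    by (intro emeasure_bounded_finite bounded_cball)
  finally have fin: "(\<Sum>n. emeasure lborel S) < \<infinity>"
    using suminf_emeasure[OF _ disj, of lborel] by (simp add: T_emeasure image_subset_iff)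
  have "emeasure lborel S < \<infinity>"
    by (rule emeasure_bounded_finite[OF bdd])
  then have eq: "emeasure lborel S = ennreal (measure lborel S)"
    by (simp add: emeasure_eq_ennreal_measure)
  have "summable (\<lambda>n::nat. measure lborel S)"
    using fin by (intro summable_suminf_not_top) (auto simp: eq)
  then show ?thesis
    by (simp add: eq summable_const_iff)
qed

section \<open>Level sets of differences of two distances\<close>

lemma norm_convex_combination_eq_imp_collinear:
  fixes v w :: "'a::real_inner"
  assumes t: "0 < t" "t < 1" and ge: "(1 - t) * norm v + t * norm w \<le> norm ((1 - t) *\<^sub>R v + t *\<^sub>R w)"
  shows "norm v *\<^sub>R w = norm w *\<^sub>R v"
proof -
  have "norm ((1 - t) *\<^sub>R v + t *\<^sub>R w) = norm ((1 - t) *\<^sub>R v) + norm (t *\<^sub>R w)"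
    using norm_triangle_ineq[of "(1 - t) *\<^sub>R v" "t *\<^sub>R w"] ge t by simp
  then have "norm ((1 - t) *\<^sub>R v) *\<^sub>R t *\<^sub>R w = norm (t *\<^sub>R w) *\<^sub>R (1 - t) *\<^sub>R v"
    by (simp only: norm_triangle_eq)
  then have "((1 - t) * t) *\<^sub>R (norm v *\<^sub>R w) = ((1 - t) * t) *\<^sub>R (norm w *\<^sub>R v)"
    using t by (simp add: mult_ac)
  then show ?thesis using t by (simp only: scaleR_cancel_left) simp
qed

text \<open>Convexity of the norm makes the difference of distances monotone in the direction
  \<open>p - p'\<close>. It could stay constant only in the equality case of the triangle
  inequality, which would place \<open>x\<close> on the line through \<open>p\<close> and
  \<open>p'\<close>.\<close>

lemma dist_difference_strict_along_line:
  fixes p p' x :: "'a::real_inner"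
  assumes t: "0 < t" and neq: "p \<noteq> p'" and off: "\<And>s. x \<noteq> p' + s *\<^sub>R (p - p')"
  shows "norm (x - p) - norm (x - p') \<noteq> norm (x + t *\<^sub>R (p - p') - p) - norm (x + t *\<^sub>R (p - p') - p')"
proof
  define u where "u = p - p'"
  define A where "A = x - p'"
  have off': "A \<noteq> s *\<^sub>R u" for s
    using off[of s] by (auto simp: A_def u_def algebra_simps)
  have u0: "u \<noteq> 0"
    using neq by (simp add: u_def)
  assume "norm (x - p) - norm (x - p') = norm (x + t *\<^sub>R (p - p') - p) - norm (x + t *\<^sub>R (p - p') - p')"
  then have eq: "norm (A - u) + norm (A + t *\<^sub>R u) = norm A + norm (A + (t - 1) *\<^sub>R u)"
    by (simp add: A_def u_def algebra_simps)
  \<comment> \<open>With \<open>v = A - u\<close> and \<open>w = A + t u\<close>, the points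
    \<open>A\<close> and \<open>A + (t - 1) u\<close> divide the segment from \<open>v\<close> to
    \<open>w\<close> with weights \<open>l\<close> and \<open>1 - l\<close> interchanged. Convexity
    bounds the sum of their norms by \<open>norm v + norm w\<close>; \<open>eq\<close> says that
    this is an equality, hence it is one at \<open>A\<close> already.\<close>
  define l where "l = 1 / (1 + t)"
  have l: "0 < l" "l < 1" "l * (1 + t) = 1"
    using t by (auto simp: l_def)
  define v where "v = A - u"
  define w where "w = A + t *\<^sub>R u"
  have e1: "(1 - l) *\<^sub>R v + l *\<^sub>R w = A"
  proof -
    have "(1 - l) *\<^sub>R v + l *\<^sub>R w = A + (l * (1 + t) - 1) *\<^sub>R u"
      by (simp add: v_def w_def algebra_simps)
    then show ?thesis using l(3) by simp
  qed
  have e2: "(1 - (1 - l)) *\<^sub>R v + (1 - l) *\<^sub>R w = A + (t - 1) *\<^sub>R u"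
  proof -
    have "(1 - (1 - l)) *\<^sub>R v + (1 - l) *\<^sub>R w = A + (t - l * (1 + t)) *\<^sub>R u"
      by (simp add: v_def w_def algebra_simps)
    then show ?thesis using l(3) by simp
  qed
  have "norm (A + (t - 1) *\<^sub>R u) \<le> l * norm v + (1 - l) * norm w"
    using norm_triangle_ineq[of "(1 - (1 - l)) *\<^sub>R v" "(1 - l) *\<^sub>R w"] l by (simp add: e2[simplified])
  moreover have "l * norm v + (1 - l) * norm w + ((1 - l) * norm v + l * norm w) = norm v + norm w"
    by (simp add: algebra_simps)
  ultimately have "(1 - l) * norm v + l * norm w \<le> norm A"
    using eq by (simp add: v_def w_def)
  then have nvw: "norm v *\<^sub>R w = norm w *\<^sub>R v"
    using norm_convex_combination_eq_imp_collinear[OF l(1,2), of v w] by (simp add: e1)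
  have "b *\<^sub>R w = a *\<^sub>R v \<Longrightarrow> (a - b) *\<^sub>R A = (b * t + a) *\<^sub>R u" for a b
    by (simp add: v_def w_def algebra_simps)
  then have col: "(norm w - norm v) *\<^sub>R A = (norm v * t + norm w) *\<^sub>R u"
    using nvw by blast
  show False
  proof (cases "norm w = norm v")
    case True
    then have "norm v * t + norm w = 0"
      using col u0 by simp
    then have "norm v = 0"
      using True t by (metis add_nonneg_eq_0_iff mult_nonneg_nonneg norm_ge_zero less_imp_le)
    then show False
      using off'[of 1] by (simp add: v_def)
  next
    case False
    then have "A = ((norm v * t + norm w) / (norm w - norm v)) *\<^sub>R u"
      using arg_cong[OF col, of "scaleR (inverse (norm w - norm v))"]
      by (simp add: divide_inverse_commute)
    then show False using off' by blast
  qed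
qed

lemma affine_line_null_set:
  fixes p' u :: "'a::euclidean_space"
  assumes "2 \<le> DIM('a)"
  shows "{x. \<exists>s. x = p' + s *\<^sub>R u} \<in> null_sets lebesgue"
proof -
  have "{x. \<exists>s. x = p' + s *\<^sub>R u} = (\<lambda>x. p' + x) ` span {u}"
    by (auto simp: span_singleton)
  moreover have "negligible (span {u})"
    using assms dim_singleton[of u] by (intro negligible_lowdim) (auto split: if_splits)
  ultimately show ?thesis
    by (simp add: negligible_translation negligible_iff_null_sets[symmetric])
qed

text \<open>Off the line \<open>T\<close> through \<open>p\<close> and \<open>p'\<close> the
  difference changes strictly under shifts by positive multiples of \<open>p - p'\<close>, so
  disjoint translates apply to \<open>S - T\<close>. On \<open>T\<close> beyond the two points the
  difference is constant and a level set may contain part of a ray; there the dimension helps, since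
  a line is null.\<close>

lemma emeasure_dist_difference_level_eq_0:
  fixes p p' :: "'a::euclidean_space"
  assumes dim: "2 \<le> DIM('a)" and neq: "p \<noteq> p'"
  shows "emeasure lborel {x \<in> cball 0 1. dist x p - dist x p' = s} = 0"
proof -
  define T where "T = {x. \<exists>s. x = p' + s *\<^sub>R (p - p')}"
  define S where "S = {x \<in> cball 0 1. dist x p - dist x p' = s}"
  have T: "T = (\<lambda>x. p' + x) ` span {p - p'}"
    by (auto simp: T_def span_singleton)
  have "closed T"
    unfolding T by (intro closed_translation closed_span)
  then have [measurable]: "T \<in> sets borel" by simp
  have [measurable]: "S \<in> sets borel"
    unfolding S_def by measurable
  have "T \<in> null_sets lborel"
    using affine_line_null_set[OF dim, of p' "p - p'"]
    by (simp add: null_sets_def T_def[symmetric])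
  moreover have "emeasure lborel (S - T) = 0"
  proof (rule null_set_of_disjoint_translates)
    show "bounded (S - T)"
      by (rule bounded_subset[OF bounded_cball[of 0 1]]) (auto simp: S_def)
    show "x + t *\<^sub>R (p - p') \<notin> S - T" if "x \<in> S - T" "0 < t" for x t
      using dist_difference_strict_along_line[OF that(2) neq, of x] that(1)
      by (auto simp: S_def T_def dist_norm)
  qed auto
  ultimately have "emeasure lborel ((S - T) \<union> T) = 0"
    by (intro emeasure_Un_null_set[THEN trans]) auto
  then have "emeasure lborel S = 0"
    by (metis (no_types, lifting) Un_Diff_cancel2 Un_upper1 emeasure_mono le_zero_eq \<open>T \<in> sets borel\<close> \<open>S \<in> sets borel\<close> sets.Un sets_lborel)
  then show ?thesis by (simp add: S_def)
qed

text \<open>Tonelli's theorem in the coordinate \<open>j\<close>. As \<open>w(j := y)\<close> does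
  not depend on \<open>w j\<close>, sections can be stated with points \<open>w\<close> of the full
  product instead of partial ones.\<close>

lemma emeasure_PiM_eq_0_of_section:
  assumes M: "prob_space M" and fin: "finite I" and j: "j \<in> I"
    and A: "A \<in> sets (\<Pi>\<^sub>M i\<in>I. M)"
    and sec: "\<And>w. w \<in> space (\<Pi>\<^sub>M i\<in>I. M) \<Longrightarrow> emeasure M {y \<in> space M. w(j := y) \<in> A} = 0"
  shows "A \<in> null_sets (\<Pi>\<^sub>M i\<in>I. M)"
proof -
  interpret M: prob_space M by fact
  interpret product_sigma_finite "\<lambda>_. M" by standard
  define K where "K = I - {j}"
  have I: "I = insert j K" "j \<notin> K" "finite K"
    using j fin by (auto simp: K_def)
  \<comment> \<open>A dummy value that completes a point over \<open>K\<close> to a point of the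
    full product, to which \<open>sec\<close> applies.\<close>
  obtain y0 where y0: "y0 \<in> space M"
    using M.not_empty by blast
  have [measurable]: "A \<in> sets (\<Pi>\<^sub>M i\<in>insert j K. M)"
    using A I by simp
  have "emeasure (\<Pi>\<^sub>M i\<in>I. M) A = (\<integral>\<^sup>+w. indicator A w \<partial>(\<Pi>\<^sub>M i\<in>I. M))"
    using A by simp
  also have "\<dots> = (\<integral>\<^sup>+w. (\<integral>\<^sup>+y. indicator A (w(j := y)) \<partial>M) \<partial>(\<Pi>\<^sub>M i\<in>K. M))"
    unfolding I(1) using I by (intro product_nn_integral_insert) auto
  also have "\<dots> = (\<integral>\<^sup>+w. 0 \<partial>(\<Pi>\<^sub>M i\<in>K. M))"
  proof (intro nn_integral_cong)
    fix w assume w: "w \<in> space (\<Pi>\<^sub>M i\<in>K. M)"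
    have w': "w(j := y) \<in> space (\<Pi>\<^sub>M i\<in>I. M)" if "y \<in> space M" for y
      using w that I by (auto simp: space_PiM PiE_def extensional_def)
    have "(\<lambda>y. w(j := y)) \<in> measurable M (\<Pi>\<^sub>M i\<in>insert j K. M)"
      using w by (intro measurable_fun_upd[where J = K]) auto
    then have [measurable]: "{y \<in> space M. w(j := y) \<in> A} \<in> sets M"
      by measurable
    have "(\<integral>\<^sup>+y. indicator A (w(j := y)) \<partial>M) = (\<integral>\<^sup>+y. indicator {y \<in> space M. w(j := y) \<in> A} y \<partial>M)"
      by (intro nn_integral_cong) (auto simp: indicator_def)
    also have "\<dots> = emeasure M {y \<in> space M. w(j := y) \<in> A}"
      by (intro nn_integral_indicator) measurable
    also have "\<dots> = 0"
      using sec[OF w'[OF y0]] by simp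
    finally show "(\<integral>\<^sup>+y. indicator A (w(j := y)) \<partial>M) = 0" .
  qed
  finally show ?thesis using A by auto
qed

text \<open>Fix all draws but a third one of the same ball, with index \<open>j0\<close> different
  from \<open>l\<close> and \<open>l'\<close>. Equality of the two sums then says that this draw
  lies on a level set of the difference of its distances to draws \<open>l\<close> and
  \<open>l'\<close>, which is null when these differ. Two draws alone always have equal sums, hence
  \<open>3 \<le> n\<close>.\<close>

lemma AE_sbm_distinct_distance_sums:
  fixes \<mu> :: "'a::euclidean_space measure"
  assumes \<mu>: "unit_ball_prob \<mu>" and null: "null_on_lebesgue_null \<mu>" and dim: "2 \<le> DIM('a)"
    and n: "3 \<le> n"
  shows "AE w in sbm \<mu> k n. \<forall>i\<in>{1..k}. \<forall>l\<in>{1..n}. \<forall>l'\<in>{1..n}. l \<noteq> l' \<longrightarrow>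
    (\<Sum>j\<in>{1..n}. dist (w (i, l)) (w (i, j))) \<noteq> (\<Sum>j\<in>{1..n}. dist (w (i, l')) (w (i, j)))"
proof -
  interpret prob_space \<mu> using \<mu> by (simp add: unit_ball_prob_def)
  have sets_\<mu>: "sets \<mu> = sets (restrict_space borel (cball 0 1))"
    using \<mu> by (simp add: unit_ball_prob_def)
  note space_\<mu> = space_unit_ball_prob[OF \<mu>]
  note id_meas = measurable_unit_ball_prob[OF \<mu> measurable_ident_sets[OF refl]]
  define I where "I = {1..k} \<times> {1..n}"
  define M where "M = (\<Pi>\<^sub>M il\<in>I. \<mu>)"
  have sbm: "sbm \<mu> k n = M" by (simp add: sbm_def M_def I_def)
  have fin: "finite I" by (simp add: I_def)
  have comp: "(\<lambda>w. w il) \<in> measurable M borel" if "il \<in> I" for il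
    using measurable_compose[OF measurable_component_singleton[OF that] id_meas]
    by (simp add: M_def)
  have distinct: "AE w in M. w a \<noteq> w b" if a: "a \<in> I" and b: "b \<in> I" and ab: "a \<noteq> b" for a b
  proof -
    note [measurable] = comp[OF a] comp[OF b]
    have "{w \<in> space M. w a = w b} \<in> null_sets M"
      unfolding M_def
    proof (rule emeasure_PiM_eq_0_of_section[OF prob_space_axioms fin b])
      show "{w \<in> space (Pi\<^sub>M I (\<lambda>_. \<mu>)). w a = w b} \<in> sets (Pi\<^sub>M I (\<lambda>_. \<mu>))"
        unfolding M_def[symmetric] by measurable
      fix w assume w: "w \<in> space (Pi\<^sub>M I (\<lambda>_. \<mu>))"
      then have "w a \<in> space \<mu>" using a by (auto simp: space_PiM)
      have "emeasure \<mu> {y \<in> space \<mu>. y = w a} = 0"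
      proof (rule null[unfolded null_on_lebesgue_null_def, rule_format])
        show "{y \<in> space \<mu>. y = w a} \<in> sets \<mu>"
          using id_meas by measurable
        have "emeasure lborel {y \<in> space \<mu>. y = w a} \<le> emeasure lborel {w a}"
          by (intro emeasure_mono) auto
        then show "emeasure lborel {y \<in> space \<mu>. y = w a} = 0" by simp
      qed
      moreover have "{y \<in> space \<mu>. w(b := y) \<in> {w \<in> space (Pi\<^sub>M I (\<lambda>_. \<mu>)). w a = w b}}
          = {y \<in> space \<mu>. y = w a}"
        using w ab b by (auto simp: space_PiM PiE_def extensional_def)
      ultimately show "emeasure \<mu> {y \<in> space \<mu>. w(b := y) \<in> {w \<in> space (Pi\<^sub>M I (\<lambda>_. \<mu>)). w a = w b}} = 0"
        by simp
    qed
    then show ?thesis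
      by (rule AE_I') auto
  qed
  have sums: "AE w in M. (\<Sum>j\<in>{1..n}. dist (w (i, l)) (w (i, j))) \<noteq> (\<Sum>j\<in>{1..n}. dist (w (i, l')) (w (i, j)))"
    if i: "i \<in> {1..k}" and l: "l \<in> {1..n}" and l': "l' \<in> {1..n}" and ll': "l \<noteq> l'" for i l l'
  proof -
    have "\<not> {1..n} \<subseteq> {l, l'}"
    proof
      assume "{1..n} \<subseteq> {l, l'}"
      then have "card {1..n} \<le> card {l, l'}" by (intro card_mono) auto
      then show False using n card_insert_le_m1[of 2 "{l'}" l] by simp
    qed
    then obtain j0 where j0: "j0 \<in> {1..n}" "j0 \<noteq> l" "j0 \<noteq> l'" by blast
    define a b e where "a = (i, l)" and "b = (i, l')" and "e = (i, j0)"
    have abe: "a \<in> I" "b \<in> I" "e \<in> I" "a \<noteq> b" "a \<noteq> e" "b \<noteq> e"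
      using i l l' ll' j0 by (auto simp: a_def b_def e_def I_def)
    define S where "S w x = (\<Sum>j\<in>{1..n}. dist (x::'a) (w (i, j)))" for w x
    have S_split: "S w x = dist x (w e) + (\<Sum>j\<in>{1..n} - {j0}. dist x (w (i, j)))" for w x
      unfolding S_def e_def using j0 by (subst sum.remove[of _ j0]) auto
    have S_meas: "(\<lambda>w. S w (w c)) \<in> borel_measurable M" if "c \<in> I" for c
      unfolding S_def using comp that i by (intro borel_measurable_sum borel_measurable_dist) (auto simp: I_def)
    define A where "A = {w \<in> space M. w a \<noteq> w b \<and> S w (w a) = S w (w b)}"
    note [measurable] = comp[OF abe(1)] comp[OF abe(2)] S_meas[OF abe(1)] S_meas[OF abe(2)]
    have A_meas: "A \<in> sets M"
    proof -
      have "{w \<in> space M. w a = w b} \<in> sets M"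
        by measurable
      moreover have "{w \<in> space M. S w (w a) = S w (w b)} \<in> sets M"
        using S_meas[OF abe(1)] S_meas[OF abe(2)] by (rule borel_measurable_eq)
      moreover have "A = {w \<in> space M. S w (w a) = S w (w b)} - {w \<in> space M. w a = w b}"
        by (auto simp: A_def)
      ultimately show ?thesis by (simp only: sets.Diff)
    qed
    have "A \<in> null_sets M"
      unfolding M_def
    proof (rule emeasure_PiM_eq_0_of_section[OF prob_space_axioms fin abe(3)])
      show "A \<in> sets (Pi\<^sub>M I (\<lambda>_. \<mu>))"
        using A_meas by (simp add: M_def)
      fix w assume w: "w \<in> space (Pi\<^sub>M I (\<lambda>_. \<mu>))"
      show "emeasure \<mu> {y \<in> space \<mu>. w(e := y) \<in> A} = 0"
      proof (cases "w a = w b")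
        case True
        then show ?thesis using abe by (simp add: A_def)
      next
        case False
        define R where "R x = (\<Sum>j\<in>{1..n} - {j0}. dist x (w (i, j)))" for x
        have S_upd: "S (w(e := y)) x = dist x y + R x" for x y
          unfolding S_split R_def by (auto intro!: sum.cong simp: e_def)
        define D where "D = {y \<in> cball 0 1. dist y (w a) - dist y (w b) = R (w b) - R (w a)}"
        have "w(e := y) \<in> space M" if "y \<in> space \<mu>" for y
          using w that abe by (auto simp: M_def space_PiM PiE_def extensional_def)
        then have "{y \<in> space \<mu>. w(e := y) \<in> A} = D"
          using abe False by (auto simp: A_def D_def S_upd space_\<mu> dist_commute algebra_simps)
        moreover have "emeasure \<mu> D = 0"
        proof (rule null[unfolded null_on_lebesgue_null_def, rule_format])
          show "D \<in> sets \<mu>"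
            unfolding sets_\<mu> D_def sets_restrict_space
            by (rule image_eqI[of _ _ "{y \<in> cball 0 1. dist y (w a) - dist y (w b) = R (w b) - R (w a)}"]) auto
          show "emeasure lborel D = 0"
            unfolding D_def by (rule emeasure_dist_difference_level_eq_0[OF dim False])
        qed
        ultimately show ?thesis by simp
      qed
    qed
    then have "AE w in M. w \<notin> A"
      by (rule AE_not_in)
    with distinct[OF abe(1,2,4)] AE_space show ?thesis
      by eventually_elim (simp add: A_def S_def a_def b_def)
  qed
  show ?thesis
    unfolding sbm using sums
    by (simp only: AE_ball_countable countable_finite finite_atLeastAtMost) (auto simp: AE_impI)
qed

subsection \<open>Measurability of exact recovery\<close>

text \<open>Optimality for an arbitrary cost vector \<open>D\<close>: the index set \<open>J\<close> stays fixed while the sample,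
  and with it the distances \<open>D\<close>, varies.\<close>

definition lp_unique_min ::
  "'b set \<Rightarrow> nat \<Rightarrow> ('b \<times> 'b \<Rightarrow> real) \<Rightarrow> ('b \<Rightarrow> real) \<Rightarrow> ('b \<Rightarrow> 'b \<Rightarrow> real) \<Rightarrow> bool" where
  "lp_unique_min J k D y z \<longleftrightarrow> lp_feasible J k y z \<and>
     (\<forall>y' z'. lp_feasible J k y' z' \<longrightarrow>
        (\<forall>a\<in>J. y' a = y a) \<and> (\<forall>a\<in>J. \<forall>b\<in>J. z' a b = z a b) \<or>
        (\<Sum>a\<in>J. \<Sum>b\<in>J. D (a, b) * z a b) < (\<Sum>a\<in>J. \<Sum>b\<in>J. D (a, b) * z' a b))"

section \<open>Transport of the program from points to indices\<close>

lemma lp_feasible_cong: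
  assumes "\<And>a. a \<in> J \<Longrightarrow> y a = y' a" "\<And>a b. a \<in> J \<Longrightarrow> b \<in> J \<Longrightarrow> z a b = z' a b"
  shows "lp_feasible J k y z \<longleftrightarrow> lp_feasible J k y' z'"
  using assms by (simp add: lp_feasible_def)

lemma lp_unique_min_cong:
  assumes "\<And>a b. a \<in> J \<Longrightarrow> b \<in> J \<Longrightarrow> D (a, b) = D' (a, b)"
    and y: "\<And>a. a \<in> J \<Longrightarrow> y a = y' a" and z: "\<And>a b. a \<in> J \<Longrightarrow> b \<in> J \<Longrightarrow> z a b = z' a b"
  shows "lp_unique_min J k D y z \<longleftrightarrow> lp_unique_min J k D' y' z'"
proof -
  have "(\<Sum>a\<in>J. \<Sum>b\<in>J. D (a, b) * z0 a b) = (\<Sum>a\<in>J. \<Sum>b\<in>J. D' (a, b) * z0 a b)" for z0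
    using assms by (intro sum.cong) auto
  moreover have "(\<Sum>a\<in>J. \<Sum>b\<in>J. D (a, b) * z a b) = (\<Sum>a\<in>J. \<Sum>b\<in>J. D' (a, b) * z' a b)"
    using assms by (intro sum.cong) auto
  moreover have "lp_feasible J k y z \<longleftrightarrow> lp_feasible J k y' z'"
    using y z by (rule lp_feasible_cong)
  ultimately show ?thesis
    using y z by (simp add: lp_unique_min_def)
qed

text \<open>A different feasible solution of no larger cost would be optimal itself, so uniqueness
  amounts to a strict inequality against all different feasible solutions.\<close>

lemma lp_unique_optimal_iff_unique_min:
  "lp_unique_optimal P k y z \<longleftrightarrow> lp_unique_min P k (\<lambda>(p, q). dist p q) y z"
proof
  assume opt: "lp_unique_optimal P k y z"
  have less: "lp_cost P z < lp_cost P z'"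
    if "lp_feasible P k y' z'" "\<not> ((\<forall>p\<in>P. y' p = y p) \<and> (\<forall>p\<in>P. \<forall>q\<in>P. z' p q = z p q))" for y' z'
  proof (rule ccontr)
    assume "\<not> lp_cost P z < lp_cost P z'"
    then have "lp_optimal P k y' z'"
      using opt that(1) unfolding lp_unique_optimal_def lp_optimal_def
      by (meson not_less order_trans)
    then show False
      using opt that(2) unfolding lp_unique_optimal_def by blast
  qed
  have "lp_feasible P k y z"
    using opt by (simp add: lp_unique_optimal_def lp_optimal_def)
  then show "lp_unique_min P k (\<lambda>(p, q). dist p q) y z"
    unfolding lp_unique_min_def prod.case lp_cost_def[symmetric] using less by blast
next
  assume um: "lp_unique_min P k (\<lambda>(p, q). dist p q) y z"
  have feas: "lp_feasible P k y z"
    using um by (simp add: lp_unique_min_def)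
  have main: "(\<forall>p\<in>P. y' p = y p) \<and> (\<forall>p\<in>P. \<forall>q\<in>P. z' p q = z p q) \<or> lp_cost P z < lp_cost P z'"
    if "lp_feasible P k y' z'" for y' z'
    using um that by (simp add: lp_unique_min_def lp_cost_def)
  have opt: "lp_cost P z \<le> lp_cost P z'" if "lp_feasible P k y' z'" for y' z'
    using main[OF that] by (auto simp: lp_cost_def)
  show "lp_unique_optimal P k y z"
    unfolding lp_unique_optimal_def lp_optimal_def
  proof (intro conjI allI impI)
    fix y' z'
    assume "lp_feasible P k y' z' \<and> (\<forall>y'' z''. lp_feasible P k y'' z'' \<longrightarrow> lp_cost P z' \<le> lp_cost P z'')"
    then have "(\<forall>p\<in>P. y' p = y p) \<and> (\<forall>p\<in>P. \<forall>q\<in>P. z' p q = z p q)"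
      using main[of y' z'] feas not_less by blast
    then show "\<forall>p\<in>P. y' p = y p" "\<forall>p\<in>P. \<forall>q\<in>P. z' p q = z p q"
      by simp_all
  qed (use feas opt in simp_all)
qed

lemma lp_feasible_image:
  assumes "inj_on x J"
  shows "lp_feasible (x ` J) k y z \<longleftrightarrow> lp_feasible J k (\<lambda>a. y (x a)) (\<lambda>a b. z (x a) (x b))"
  using assms by (simp add: lp_feasible_def sum.reindex)

lemma ip_feasible_image:
  assumes "inj_on x J"
  shows "ip_feasible (x ` J) k y z \<longleftrightarrow> ip_feasible J k (\<lambda>a. y (x a)) (\<lambda>a b. z (x a) (x b))"
  using assms by (simp add: ip_feasible_def sum.reindex)

lemma lp_unique_min_image:
  assumes inj: "inj_on x J"
  shows "lp_unique_min (x ` J) k D y z \<longleftrightarrow>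
    lp_unique_min J k (\<lambda>(a, b). D (x a, x b)) (\<lambda>a. y (x a)) (\<lambda>a b. z (x a) (x b))" (is "?l \<longleftrightarrow> ?r")
proof
  define g where "g = the_inv_into J x"
  have g: "g (x a) = a" if "a \<in> J" for a
    using that inj by (simp add: g_def the_inv_into_f_f)
  assume l: ?l
  show ?r
    unfolding lp_unique_min_def
  proof (intro conjI allI impI)
    show "lp_feasible J k (\<lambda>a. y (x a)) (\<lambda>a b. z (x a) (x b))"
      using l lp_feasible_image[OF inj] by (simp add: lp_unique_min_def)
    fix y' z' assume "lp_feasible J k y' z'"
    then have f: "lp_feasible (x ` J) k (\<lambda>p. y' (g p)) (\<lambda>p q. z' (g p) (g q))"
      unfolding lp_feasible_image[OF inj] using g by (subst lp_feasible_cong[of _ _ y' _ z']) auto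
    have "(\<Sum>a\<in>J. \<Sum>b\<in>J. D (x a, x b) * z' (g (x a)) (g (x b))) = (\<Sum>a\<in>J. \<Sum>b\<in>J. D (x a, x b) * z' a b)"
      by (intro sum.cong) (auto simp: g)
    then show "(\<forall>a\<in>J. y' a = y (x a)) \<and> (\<forall>a\<in>J. \<forall>b\<in>J. z' a b = z (x a) (x b)) \<or>
        (\<Sum>a\<in>J. \<Sum>b\<in>J. (case (a, b) of (a, b) \<Rightarrow> D (x a, x b)) * z (x a) (x b))
      < (\<Sum>a\<in>J. \<Sum>b\<in>J. (case (a, b) of (a, b) \<Rightarrow> D (x a, x b)) * z' a b)"
      using l[unfolded lp_unique_min_def, THEN conjunct2, rule_format, OF f]
      by (simp add: sum.reindex[OF inj] g)
  qed
next
  assume r: ?r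
  show ?l
    unfolding lp_unique_min_def
  proof (intro conjI allI impI)
    show "lp_feasible (x ` J) k y z"
      using r lp_feasible_image[OF inj] by (simp add: lp_unique_min_def)
    fix y' z' assume "lp_feasible (x ` J) k y' z'"
    then have "lp_feasible J k (\<lambda>a. y' (x a)) (\<lambda>a b. z' (x a) (x b))"
      by (simp add: lp_feasible_image[OF inj])
    then show "(\<forall>a\<in>x ` J. y' a = y a) \<and> (\<forall>a\<in>x ` J. \<forall>b\<in>x ` J. z' a b = z a b) \<or>
        (\<Sum>a\<in>x ` J. \<Sum>b\<in>x ` J. D (a, b) * z a b) < (\<Sum>a\<in>x ` J. \<Sum>b\<in>x ` J. D (a, b) * z' a b)"
      using r[unfolded lp_unique_min_def, THEN conjunct2, rule_format, of "\<lambda>a. y' (x a)" "\<lambda>a b. z' (x a) (x b)"]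
      by (simp add: sum.reindex[OF inj])
  qed
qed

text \<open>A solution feasible for the integer program has values 0 and 1 only and is encoded by
  index sets \<open>Y\<close> and \<open>Z\<close>. The existential over real-valued solutions thus
  becomes one over finitely many candidates when \<open>J\<close> is finite, and only the last
  conjunct depends on the positions \<open>x\<close>.\<close>

lemma lp_exact_recovery_image_iff:
  assumes inj: "inj_on x J" and J: "J = (\<Union>i\<in>{1..k}. T i)"
  shows "lp_exact_recovery k (\<lambda>i. x ` T i) \<longleftrightarrow>
    (\<exists>(Y, Z)\<in>Pow J \<times> Pow (J \<times> J).
       ip_feasible J k (indicator Y) (\<lambda>a b. indicator Z (a, b)) \<and>
       (\<forall>i\<in>{1..k}. \<exists>!a. a \<in> T i \<and> a \<in> Y) \<and>
       (\<forall>a\<in>J. \<forall>b\<in>J. (a, b) \<in> Z \<longrightarrow> (\<exists>i\<in>{1..k}. a \<in> T i \<and> b \<in> T i)) \<and>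
       lp_unique_min J k (\<lambda>(a, b). dist (x a) (x b)) (indicator Y) (\<lambda>a b. indicator Z (a, b)))"
    (is "?l \<longleftrightarrow> (\<exists>(Y, Z)\<in>_. ?R Y Z)")
proof -
  have P: "(\<Union>i\<in>{1..k}. x ` T i) = x ` J"
    using J by auto
  have T: "T i \<subseteq> J" if "i \<in> {1..k}" for i using that J by auto
  have mem: "x a \<in> x ` T i \<longleftrightarrow> a \<in> T i" if "i \<in> {1..k}" "a \<in> J" for i a
    using inj_on_image_mem_iff[OF inj that(2) T[OF that(1)]] .
  have ex1: "(\<exists>!p. p \<in> x ` T i \<and> y p = 1) \<longleftrightarrow> (\<exists>!a. a \<in> T i \<and> y (x a) = 1)"
    if "i \<in> {1..k}" for i and y :: "'b \<Rightarrow> real"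
  proof -
    have "inj_on x (T i)" using inj T[OF that] by (rule inj_on_subset)
    then have injT: "a = b" if "x a = x b" "a \<in> T i" "b \<in> T i" for a b
      using that by (auto dest: inj_onD)
    show ?thesis
    proof
      assume "\<exists>!p. p \<in> x ` T i \<and> y p = 1"
      then obtain a where a: "a \<in> T i" "y (x a) = 1"
        and uniq: "\<And>q. q \<in> x ` T i \<Longrightarrow> y q = 1 \<Longrightarrow> q = x a" by blast
      show "\<exists>!a. a \<in> T i \<and> y (x a) = 1"
      proof (rule ex1I[of _ a])
        show "b = a" if "b \<in> T i \<and> y (x b) = 1" for b
          using that uniq[of "x b"] a injT[of b a] by blast
      qed (use a in blast)
    next
      assume "\<exists>!a. a \<in> T i \<and> y (x a) = 1"
      then obtain a where a: "a \<in> T i" "y (x a) = 1"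
        and uniq: "\<And>b. b \<in> T i \<Longrightarrow> y (x b) = 1 \<Longrightarrow> b = a" by blast
      show "\<exists>!p. p \<in> x ` T i \<and> y p = 1"
      proof (rule ex1I[of _ "x a"])
        show "p = x a" if "p \<in> x ` T i \<and> y p = 1" for p
          using that uniq by blast
      qed (use a in blast)
    qed
  qed
  define RR where "RR Y Z \<longleftrightarrow> ?R Y Z" for Y Z
  have "?l \<longleftrightarrow> (\<exists>(Y, Z)\<in>Pow J \<times> Pow (J \<times> J). RR Y Z)"
  proof
    assume ?l
    then obtain y z where opt: "lp_unique_optimal (x ` J) k y z" and ip: "ip_feasible (x ` J) k y z"
      and one: "\<forall>i\<in>{1..k}. \<exists>!p. p \<in> x ` T i \<and> y p = 1"
      and cl: "\<forall>p\<in>x ` J. \<forall>q\<in>x ` J. z p q = 1 \<longrightarrow> (\<exists>i\<in>{1..k}. p \<in> x ` T i \<and> q \<in> x ` T i)"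
      unfolding lp_exact_recovery_def Let_def P by blast
    define Y where "Y = {a \<in> J. y (x a) = 1}"
    define Z where "Z = {(a, b) \<in> J \<times> J. z (x a) (x b) = 1}"
    have Y: "y (x a) = indicator Y a" if "a \<in> J" for a
      using ip that by (auto simp: ip_feasible_def Y_def indicator_def)
    have Z: "z (x a) (x b) = indicator Z (a, b)" if "a \<in> J" "b \<in> J" for a b
      using ip that by (auto simp: ip_feasible_def Z_def indicator_def)
    have um: "lp_unique_min J k (\<lambda>(a, b). dist (x a) (x b)) (\<lambda>a. y (x a)) (\<lambda>a b. z (x a) (x b)) \<longleftrightarrow>
      lp_unique_min J k (\<lambda>(a, b). dist (x a) (x b)) (indicator Y) (\<lambda>a b. indicator Z (a, b))"
      by (rule lp_unique_min_cong) (simp_all add: Y Z)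
    have "RR Y Z"
      unfolding RR_def
    proof (intro conjI)
      show "ip_feasible J k (indicator Y) (\<lambda>a b. indicator Z (a, b))"
        using ip Y Z unfolding ip_feasible_image[OF inj] by (simp add: ip_feasible_def)
      show "\<forall>i\<in>{1..k}. \<exists>!a. a \<in> T i \<and> a \<in> Y"
      proof
        fix i assume i: "i \<in> {1..k}"
        have "a \<in> T i \<and> y (x a) = 1 \<longleftrightarrow> a \<in> T i \<and> a \<in> Y" for a
          using T[OF i] by (auto simp: Y_def)
        then show "\<exists>!a. a \<in> T i \<and> a \<in> Y"
          using one[rule_format, OF i] ex1[OF i, of y] by (simp only:)
      qed
      show "\<forall>a\<in>J. \<forall>b\<in>J. (a, b) \<in> Z \<longrightarrow> (\<exists>i\<in>{1..k}. a \<in> T i \<and> b \<in> T i)"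
      proof (intro ballI impI)
        fix a b assume ab: "a \<in> J" "b \<in> J" "(a, b) \<in> Z"
        then have "z (x a) (x b) = 1" by (simp add: Z_def)
        then obtain i where "i \<in> {1..k}" "x a \<in> x ` T i" "x b \<in> x ` T i"
          using cl ab by blast
        then show "\<exists>i\<in>{1..k}. a \<in> T i \<and> b \<in> T i"
          using mem ab by blast
      qed
      show "lp_unique_min J k (\<lambda>(a, b). dist (x a) (x b)) (indicator Y) (\<lambda>a b. indicator Z (a, b))"
        using opt um
        by (simp add: lp_unique_optimal_iff_unique_min lp_unique_min_image[OF inj])
    qed
    moreover have "(Y, Z) \<in> Pow J \<times> Pow (J \<times> J)"
      by (auto simp: Y_def Z_def)
    ultimately show "\<exists>(Y, Z)\<in>Pow J \<times> Pow (J \<times> J). RR Y Z"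
      by blast
  next
    assume "\<exists>(Y, Z)\<in>Pow J \<times> Pow (J \<times> J). RR Y Z"
    then obtain Y Z where YZ: "Y \<subseteq> J" "Z \<subseteq> J \<times> J" and "RR Y Z" by auto
    from this(3) have R: "?R Y Z" unfolding RR_def .
    define g where "g = the_inv_into J x"
    have g: "g (x a) = a" if "a \<in> J" for a
      using that inj by (simp add: g_def the_inv_into_f_f)
    define y where "y p = (indicator Y (g p) :: real)" for p
    define z where "z p q = (indicator Z (g p, g q) :: real)" for p q
    have Y: "y (x a) = indicator Y a" if "a \<in> J" for a
      using that by (simp add: y_def g)
    have Z: "z (x a) (x b) = indicator Z (a, b)" if "a \<in> J" "b \<in> J" for a b
      using that by (simp add: z_def g)
    have um: "lp_unique_min J k (\<lambda>(a, b). dist (x a) (x b)) (\<lambda>a. y (x a)) (\<lambda>a b. z (x a) (x b)) \<longleftrightarrow>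
      lp_unique_min J k (\<lambda>(a, b). dist (x a) (x b)) (indicator Y) (\<lambda>a b. indicator Z (a, b))"
      by (rule lp_unique_min_cong) (simp_all add: Y Z)
    have 1: "lp_unique_optimal (x ` J) k y z"
      using R um
      by (simp add: lp_unique_optimal_iff_unique_min lp_unique_min_image[OF inj])
    have 2: "ip_feasible (x ` J) k y z"
      using R Y Z unfolding ip_feasible_image[OF inj] by (simp add: ip_feasible_def)
    have 3: "\<exists>!p. p \<in> x ` T i \<and> y p = 1" if i: "i \<in> {1..k}" for i
    proof -
      have "a \<in> T i \<and> y (x a) = 1 \<longleftrightarrow> a \<in> T i \<and> a \<in> Y" for a
        using T[OF i] Y by (auto simp: indicator_def)
      then show ?thesis
        using R[THEN conjunct2, THEN conjunct1, rule_format, OF i] ex1[OF i, of y] by (simp only:)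
    qed
    have 4: "\<exists>i\<in>{1..k}. p \<in> x ` T i \<and> q \<in> x ` T i"
      if pq: "p \<in> x ` J" "q \<in> x ` J" "z p q = 1" for p q
    proof -
      obtain a b where ab: "a \<in> J" "b \<in> J" "p = x a" "q = x b"
        using pq by auto
      then have "indicator Z (a, b) = (1::real)"
        using pq(3) Z[OF ab(1,2)] by simp
      then have "(a, b) \<in> Z"
        by (simp add: indicator_eq_1_iff)
      then obtain i where "i \<in> {1..k}" "a \<in> T i" "b \<in> T i"
        using R[THEN conjunct2, THEN conjunct2, THEN conjunct1] ab by blast
      then show ?thesis using ab by blast
    qed
    show ?l
      unfolding lp_exact_recovery_def Let_def P
      by (intro exI conjI ballI impI) (fact 1, fact 2, erule 3, erule (2) 4)
  qed
  then show ?thesis unfolding RR_def .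
qed

section \<open>Unique optimality as a Borel condition on the costs\<close>

lemma closed_projection_along_compact:
  fixes C :: "('a::topological_space \<times> 'b::topological_space) set"
  assumes K: "compact K" and C: "closed C"
  shows "closed {D. \<exists>w\<in>K. (D, w) \<in> C}"
proof -
  have "open (- {D. \<exists>w\<in>K. (D, w) \<in> C})"
  proof (subst open_subopen, intro ballI)
    fix D assume "D \<in> - {D. \<exists>w\<in>K. (D, w) \<in> C}"
    then have "{D} \<times> K \<subseteq> - C" by auto
    then obtain X where "D \<in> X" "open X" "X \<times> K \<subseteq> - C"
      using Elementary_Topology.tube_lemma[OF K, of "- C" D] C by (auto simp: open_Compl)
    then show "\<exists>T. open T \<and> D \<in> T \<and> T \<subseteq> - {D. \<exists>w\<in>K. (D, w) \<in> C}"
      by (intro exI[of _ X]) blast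
  qed
  then show ?thesis by (simp add: closed_def)
qed

text \<open>Over the variables at distance at least \<open>1 / Suc m\<close> from \<open>(y, z)\<close> the feasible region is
  compact, hence the cost vectors for which some such point is at least as good as \<open>(y, z)\<close> form
  a closed set.\<close>

lemma borel_lp_unique_min:
  fixes J :: "'b::countable set"
  assumes fin: "finite J"
  shows "{D. lp_unique_min J k D y z} \<in> sets borel"
proof (cases "lp_feasible J k y z")
  case False
  then have "{D. lp_unique_min J k D y z} = {}" by (simp add: lp_unique_min_def)
  then show ?thesis by (metis sets.empty_sets)
next
  case True
  define feas where "feas w \<longleftrightarrow> lp_feasible J k (\<lambda>a. w (Inl a)) (\<lambda>a b. w (Inr (a, b)))"
    for w :: "'b + 'b \<times> 'b \<Rightarrow> real"
  define v where "v = case_sum y (\<lambda>(a, b). z a b)"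
  define E where "E = Inl ` J \<union> Inr ` (J \<times> J)"
  \<comment> \<open>Every feasible point satisfies \<open>z \<le> y \<le> k\<close> on
    \<open>J\<close>, so the box loses no solution. It also bounds the coordinates outside
    \<open>E\<close>, which feasibility leaves free; a product of compact intervals is compact even
    over infinitely many coordinates.\<close>
  define F where "F m = {w. feas w \<and> (\<exists>e\<in>E. inverse (real (Suc m)) \<le> \<bar>w e - v e\<bar>)} \<inter> PiE UNIV (\<lambda>_. {0..real k})" for m
  define cost where "cost D w = (\<Sum>a\<in>J. \<Sum>b\<in>J. D (a, b) * w (Inr (a, b)))"
    for D :: "'b \<times> 'b \<Rightarrow> real" and w :: "'b + 'b \<times> 'b \<Rightarrow> real"
  have coord: "continuous_on UNIV (\<lambda>w::_ \<Rightarrow> real. w e)" for e :: "'b + 'b \<times> 'b"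
    by (rule continuous_on_product_coordinates)
  have closed_ball: "closed {w. \<forall>x\<in>A. P w x}" if "\<And>x. x \<in> A \<Longrightarrow> closed {w. P w x}"
    for A :: "'c set" and P :: "('b + 'b \<times> 'b \<Rightarrow> real) \<Rightarrow> 'c \<Rightarrow> bool"
  proof -
    have "{w. \<forall>x\<in>A. P w x} = (\<Inter>x\<in>A. {w. P w x})" by auto
    then show ?thesis using that by auto
  qed
  have cl_feas: "closed {w. feas w}"
    unfolding feas_def lp_feasible_def
    by (intro closed_Collect_conj closed_ball closed_Collect_eq closed_Collect_le
        continuous_on_sum continuous_on_const coord)
  have cl_far: "closed {w. \<exists>e\<in>E. inverse (real (Suc m)) \<le> \<bar>w e - v e\<bar>}" for m
  proof -
    have "{w. \<exists>e\<in>E. inverse (real (Suc m)) \<le> \<bar>w e - v e\<bar>} =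
      (\<Union>e\<in>E. {w. inverse (real (Suc m)) \<le> \<bar>w e - v e\<bar>})" by auto
    also have "closed \<dots>"
      using fin by (intro closed_UN closed_Collect_le continuous_on_const continuous_on_rabs
          continuous_on_diff coord ballI) (auto simp: E_def)
    finally show ?thesis .
  qed
  have "compact (PiE (UNIV :: ('b + 'b \<times> 'b) set) (\<lambda>_. {0..real k}))"
    using compactin_PiE[of "\<lambda>_. euclidean" "UNIV :: ('b + 'b \<times> 'b) set" "\<lambda>_. {0..real k}"]
    by (simp add: euclidean_product_topology)
  then have compact_F: "compact (F m)" for m
    unfolding F_def using cl_feas cl_far[of m]
    by (intro closed_Int_compact closed_Collect_conj)
  have cl_bad: "closed {D. \<exists>w\<in>F m. (D, w) \<in> {(D, w). cost D w \<le> cost D v}}" for m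
  proof (rule closed_projection_along_compact[OF compact_F])
    have 1: "continuous_on UNIV (\<lambda>x::('b \<times> 'b \<Rightarrow> real) \<times> ('b + 'b \<times> 'b \<Rightarrow> real). fst x e)" for e
      by (rule continuous_on_product_then_coordinatewise) (rule continuous_on_fst[OF continuous_on_id])
    have 2: "continuous_on UNIV (\<lambda>x::('b \<times> 'b \<Rightarrow> real) \<times> ('b + 'b \<times> 'b \<Rightarrow> real). snd x e)" for e
      by (rule continuous_on_product_then_coordinatewise) (rule continuous_on_snd[OF continuous_on_id])
    show "closed {(D, w). cost D w \<le> cost D v}"
      unfolding case_prod_unfold cost_def
      by (intro closed_Collect_le continuous_on_sum continuous_on_mult 1 2 continuous_on_const)
  qed
  have "{D. lp_unique_min J k D y z} = (\<Inter>m. - {D. \<exists>w\<in>F m. (D, w) \<in> {(D, w). cost D w \<le> cost D v}})"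
  proof (intro set_eqI iffI)
    fix D assume D: "D \<in> {D. lp_unique_min J k D y z}"
    have "cost D v < cost D w" if w: "w \<in> F m" for w m
    proof -
      have "lp_feasible J k (\<lambda>a. w (Inl a)) (\<lambda>a b. w (Inr (a, b)))"
        using w by (simp add: F_def feas_def)
      moreover obtain e where "e \<in> E" "inverse (real (Suc m)) \<le> \<bar>w e - v e\<bar>"
        using w by (auto simp: F_def)
      then have "e \<in> E" "w e \<noteq> v e" by auto
      then have "\<not> ((\<forall>a\<in>J. w (Inl a) = y a) \<and> (\<forall>a\<in>J. \<forall>b\<in>J. w (Inr (a, b)) = z a b))"
        by (auto simp: E_def v_def)
      ultimately show ?thesis
        using D[simplified, unfolded lp_unique_min_def, THEN conjunct2, rule_format,
            of "\<lambda>a. w (Inl a)" "\<lambda>a b. w (Inr (a, b))"]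
        by (simp only: cost_def v_def sum.case prod.case) blast
    qed
    then show "D \<in> (\<Inter>m. - {D. \<exists>w\<in>F m. (D, w) \<in> {(D, w). cost D w \<le> cost D v}})"
      by (auto simp: not_le)
  next
    fix D assume D: "D \<in> (\<Inter>m. - {D. \<exists>w\<in>F m. (D, w) \<in> {(D, w). cost D w \<le> cost D v}})"
    have less: "cost D v < cost D w" if "w \<in> F m" for w m
      using D that by force
    have "(\<Sum>a\<in>J. \<Sum>b\<in>J. D (a, b) * z a b) < (\<Sum>a\<in>J. \<Sum>b\<in>J. D (a, b) * z' a b)"
      if f: "lp_feasible J k y' z'"
        and ne: "\<not> ((\<forall>a\<in>J. y' a = y a) \<and> (\<forall>a\<in>J. \<forall>b\<in>J. z' a b = z a b))" for y' z'
    proof -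
      define w where "w e = (if e \<in> E then case_sum y' (\<lambda>(a, b). z' a b) e else 0)" for e
      have w: "w (Inl a) = y' a" "w (Inr (a, b)) = z' a b" if "a \<in> J" "b \<in> J" for a b
        using that by (auto simp: w_def E_def)
      have feas_w: "feas w"
        unfolding feas_def using f w by (subst lp_feasible_cong[of _ _ y' _ z']) auto
      have y_bd: "0 \<le> y' a \<and> y' a \<le> real k" if "a \<in> J" for a
        using f that member_le_sum[of a J y'] fin by (auto simp: lp_feasible_def)
      have z_bd: "0 \<le> z' a b \<and> z' a b \<le> real k" if "a \<in> J" "b \<in> J" for a b
        using f that y_bd[OF that(1)] by (auto simp: lp_feasible_def intro: order_trans)
      have "w e \<in> {0..real k}" for e
        using y_bd z_bd by (auto simp: w_def E_def)
      then have box: "w \<in> PiE UNIV (\<lambda>_. {0..real k})" by auto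
      have "\<exists>e\<in>E. w e \<noteq> v e"
      proof (rule ccontr)
        assume "\<not> (\<exists>e\<in>E. w e \<noteq> v e)"
        then have "w (Inl a) = v (Inl a)" "w (Inr (a, b)) = v (Inr (a, b))" if "a \<in> J" "b \<in> J" for a b
          using that by (auto simp: E_def)
        then show False using ne w by (auto simp: v_def)
      qed
      then obtain e where e: "e \<in> E" "w e \<noteq> v e" by blast
      then obtain m where "inverse (real (Suc m)) < \<bar>w e - v e\<bar>"
        using reals_Archimedean[of "\<bar>w e - v e\<bar>"] by auto
      then have "w \<in> F m"
        using feas_w box e by (auto simp: F_def intro: less_imp_le)
      from less[OF this] show ?thesis
        using w by (simp add: cost_def v_def cong: sum.cong)
    qed
    then show "D \<in> {D. lp_unique_min J k D y z}"
      using True unfolding lp_unique_min_def by blast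
  qed
  also have "\<dots> \<in> sets borel"
    using cl_bad by (intro sets.countable_INT'' borel_open) (auto simp: open_Compl)
  finally show ?thesis .
qed

text \<open>The event is a finite union over sets \<open>J\<close> of representatives of the
  distinct points and over candidates \<open>(Y, Z)\<close>; for fixed \<open>J\<close> the index
  set of the program no longer varies with the sample. Separation of the centers ensures that only
  draws of the same ball can coincide, so each representative belongs to the right cluster.\<close>

lemma sets_lp_exact_recovery_event:
  fixes \<mu> :: "'a::euclidean_space measure"
  assumes \<mu>: "unit_ball_prob \<mu>"
    and sep: "\<And>i j. i \<in> {1..k} \<Longrightarrow> j \<in> {1..k} \<Longrightarrow> i \<noteq> j \<Longrightarrow> dist (c i) (c j) > 2"
  shows "{\<omega> \<in> space (sbm \<mu> k n). lp_exact_recovery k (sbm_cluster c n \<omega>)} \<in> sets (sbm \<mu> k n)"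
proof -
  note space_\<mu> = space_unit_ball_prob[OF \<mu>]
  note id_meas = measurable_unit_ball_prob[OF \<mu> measurable_ident_sets[OF refl]]
  define I where "I = {1..k} \<times> {1..n}"
  define M where "M = (\<Pi>\<^sub>M il\<in>I. \<mu>)"
  have sbm: "sbm \<mu> k n = M" by (simp add: sbm_def M_def I_def)
  have fin: "finite I" by (simp add: I_def)
  define x where "x \<omega> il = c (fst il) + \<omega> il" for \<omega> :: "nat \<times> nat \<Rightarrow> 'a" and il
  have x_meas: "(\<lambda>\<omega>. x \<omega> il) \<in> measurable M borel" if "il \<in> I" for il
  proof -
    have [measurable]: "(\<lambda>\<omega>. \<omega> il) \<in> measurable M borel"
      using measurable_compose[OF measurable_component_singleton[OF that] id_meas]
      by (simp add: M_def)
    show ?thesis unfolding x_def by measurable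
  qed
  have cluster: "sbm_cluster c n \<omega> i = x \<omega> ` ({i} \<times> {1..n})" for \<omega> i
  proof -
    have "{i} \<times> {1..n} = Pair i ` {1..n}" by auto
    then show ?thesis by (simp add: sbm_cluster_def x_def image_image)
  qed
  have sep_x: "x \<omega> a \<noteq> x \<omega> b" if "\<omega> \<in> space M" "a \<in> I" "b \<in> I" "fst a \<noteq> fst b" for \<omega> a b
  proof
    assume eq: "x \<omega> a = x \<omega> b"
    have "norm (\<omega> a) \<le> 1" "norm (\<omega> b) \<le> 1"
      using that PiE_mem[of \<omega> I "\<lambda>_. space \<mu>"] by (auto simp: M_def space_PiM space_\<mu>)
    moreover have "c (fst a) - c (fst b) = \<omega> b - \<omega> a"
      using eq by (simp add: x_def algebra_simps)
    ultimately have "dist (c (fst a)) (c (fst b)) \<le> 2"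
      using norm_triangle_ineq4[of "\<omega> b" "\<omega> a"] by (simp add: dist_norm)
    then show False
      using sep[of "fst a" "fst b"] that by (auto simp: I_def)
  qed
  text \<open>Sample points may coincide. \<open>Q J \<omega>\<close> says that \<open>J\<close> picks one index for each distinct point.\<close>
  define T where "T J i = J \<inter> ({i} \<times> {1..n})" for J :: "(nat \<times> nat) set" and i
  define Q where "Q J \<omega> \<longleftrightarrow> (\<forall>a\<in>J. \<forall>b\<in>J. a \<noteq> b \<longrightarrow> x \<omega> a \<noteq> x \<omega> b) \<and>
    (\<forall>a\<in>I. \<exists>b\<in>J. fst b = fst a \<and> x \<omega> a = x \<omega> b)" for J \<omega>
  define R where "R J Y Z \<longleftrightarrow> ip_feasible J k (indicator Y) (\<lambda>a b. indicator Z (a, b)) \<and>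
       (\<forall>i\<in>{1..k}. \<exists>!a. a \<in> T J i \<and> a \<in> Y) \<and>
       (\<forall>a\<in>J. \<forall>b\<in>J. (a, b) \<in> Z \<longrightarrow> (\<exists>i\<in>{1..k}. a \<in> T J i \<and> b \<in> T J i))"
    for J :: "(nat \<times> nat) set" and Y Z
  \<comment> \<open>Measurability of \<open>x \<omega> a\<close> is available for indices in
    \<open>I\<close>; setting all costs outside \<open>J\<close> to 0 makes every coordinate of the
    cost vector measurable and does not affect the program on \<open>J\<close>.\<close>
  define U where "U J Y Z \<omega> \<longleftrightarrow>
    lp_unique_min J k (\<lambda>(a, b). if a \<in> J \<and> b \<in> J then dist (x \<omega> a) (x \<omega> b) else 0)
      (indicator Y) (\<lambda>a b. indicator Z (a, b))" for J Y Z \<omega>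
  have Q_imp: "lp_exact_recovery k (sbm_cluster c n \<omega>) \<longleftrightarrow>
      (\<exists>(Y, Z)\<in>Pow J \<times> Pow (J \<times> J). R J Y Z \<and> U J Y Z \<omega>)"
    if J: "J \<subseteq> I" and Q: "Q J \<omega>" for J \<omega>
  proof -
    have inj: "inj_on (x \<omega>) J"
      using Q by (auto simp: Q_def inj_on_def)
    have JT: "J = (\<Union>i\<in>{1..k}. T J i)"
      using J by (auto simp: T_def I_def)
    have same: "x \<omega> ` T J i = sbm_cluster c n \<omega> i" if i: "i \<in> {1..k}" for i
    proof
      show "x \<omega> ` T J i \<subseteq> sbm_cluster c n \<omega> i"
        unfolding cluster T_def by blast
      show "sbm_cluster c n \<omega> i \<subseteq> x \<omega> ` T J i"
      proof
        fix p assume "p \<in> sbm_cluster c n \<omega> i"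
        then obtain l where l: "l \<in> {1..n}" "p = x \<omega> (i, l)"
          unfolding cluster by blast
        have "(i, l) \<in> I" using i l by (simp add: I_def)
        then obtain b where b: "b \<in> J" "fst b = fst (i, l)" "x \<omega> (i, l) = x \<omega> b"
          using Q unfolding Q_def by blast
        then have "b \<in> T J i"
          using J by (cases b) (auto simp: T_def I_def)
        then show "p \<in> x \<omega> ` T J i"
          using l b by blast
      qed
    qed
    have "lp_exact_recovery k (sbm_cluster c n \<omega>) \<longleftrightarrow> lp_exact_recovery k (\<lambda>i. x \<omega> ` T J i)"
      unfolding lp_exact_recovery_def Let_def by (simp add: same del: atLeastAtMost_iff)
    also have "\<dots> \<longleftrightarrow> (\<exists>(Y, Z)\<in>Pow J \<times> Pow (J \<times> J). R J Y Z \<and> U J Y Z \<omega>)"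
    proof -
      have "lp_unique_min J k (\<lambda>(a, b). dist (x \<omega> a) (x \<omega> b)) (indicator Y) (\<lambda>a b. indicator Z (a, b))
        \<longleftrightarrow> U J Y Z \<omega>" for Y Z
        unfolding U_def by (intro lp_unique_min_cong) auto
      then show ?thesis
        unfolding lp_exact_recovery_image_iff[OF inj JT] R_def by (simp add: conj_assoc)
    qed
    finally show ?thesis .
  qed
  have Q_ex: "\<exists>J\<in>Pow I. Q J \<omega>" if \<omega>: "\<omega> \<in> space M" for \<omega>
  proof -
    obtain J where J: "J \<subseteq> I" "inj_on (x \<omega>) J" "x \<omega> ` I = x \<omega> ` J"
      using subset_image_inj[of "x \<omega> ` I" "x \<omega>" I] by auto
    have "\<exists>b\<in>J. fst b = fst a \<and> x \<omega> a = x \<omega> b" if "a \<in> I" for a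
    proof -
      obtain b where "b \<in> J" "x \<omega> a = x \<omega> b"
        using J(3) \<open>a \<in> I\<close> by blast
      then show ?thesis
        using sep_x[OF \<omega> that, of b] J(1) by (metis subsetD)
    qed
    then show ?thesis
      using J unfolding Q_def inj_on_def by blast
  qed
  have Q_sets: "{\<omega> \<in> space M. Q J \<omega>} \<in> sets M" if "J \<subseteq> I" for J
  proof -
    have eq: "{\<omega> \<in> space M. x \<omega> a = x \<omega> b} \<in> sets M" if "a \<in> I" "b \<in> I" for a b
    proof -
      note [measurable] = x_meas[OF that(1)] x_meas[OF that(2)]
      show ?thesis by measurable
    qed
    have finJ: "finite J" using that fin by (rule finite_subset)
    have inj_sets: "{\<omega> \<in> space M. a \<noteq> b \<longrightarrow> x \<omega> a \<noteq> x \<omega> b} \<in> sets M" if "a \<in> J" "b \<in> J" for a b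
    proof (cases "a = b")
      case False
      have "{\<omega> \<in> space M. x \<omega> a \<noteq> x \<omega> b} \<in> sets M"
        using eq[of a b] that \<open>J \<subseteq> I\<close> by (intro sets.sets_Collect_neg) blast
      then show ?thesis using False by simp
    qed simp
    have eq_sets: "{\<omega> \<in> space M. fst b = fst a \<and> x \<omega> a = x \<omega> b} \<in> sets M"
      if "a \<in> I" "b \<in> J" for a b
    proof (cases "fst b = fst a")
      case True
      then show ?thesis using eq[of a b] that \<open>J \<subseteq> I\<close> by auto
    qed simp
    show ?thesis
      unfolding Q_def
    proof (rule sets.sets_Collect_conj)
      show "{\<omega> \<in> space M. \<forall>a\<in>J. \<forall>b\<in>J. a \<noteq> b \<longrightarrow> x \<omega> a \<noteq> x \<omega> b} \<in> sets M"
        by (rule sets.sets_Collect_finite_All[OF _ finJ])+ (rule inj_sets)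
      show "{\<omega> \<in> space M. \<forall>a\<in>I. \<exists>b\<in>J. fst b = fst a \<and> x \<omega> a = x \<omega> b} \<in> sets M"
        by (rule sets.sets_Collect_finite_All[OF _ fin], rule sets.sets_Collect_finite_Ex[OF _ finJ])
          (rule eq_sets)
    qed
  qed
  have U_sets: "{\<omega> \<in> space M. U J Y Z \<omega>} \<in> sets M" if J: "J \<subseteq> I" for J Y Z
  proof -
    define D where "D \<omega> = (\<lambda>(a, b). if a \<in> J \<and> b \<in> J then dist (x \<omega> a) (x \<omega> b) else 0)" for \<omega>
    have "D \<in> measurable M (\<Pi>\<^sub>M e\<in>UNIV. borel)"
    proof (rule measurable_PiM_single')
      fix e :: "(nat \<times> nat) \<times> (nat \<times> nat)"
      obtain a b where e: "e = (a, b)" by (cases e)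
      show "(\<lambda>\<omega>. D \<omega> e) \<in> borel_measurable M"
      proof (cases "a \<in> J \<and> b \<in> J")
        case True
        then show ?thesis
          using J by (auto simp: D_def e intro!: borel_measurable_dist x_meas)
      next
        case False
        then have "(\<lambda>\<omega>. D \<omega> e) = (\<lambda>_. 0)" by (auto simp: D_def e)
        then show ?thesis by simp
      qed
    qed auto
    \<comment> \<open>The index type is countable, so the product sigma-algebra is the Borel one and
      coordinatewise measurability suffices.\<close>
    then have "D \<in> borel_measurable M"
      by (simp cong: measurable_cong_sets add: sets_PiM_equal_borel)
    moreover have "{D. lp_unique_min J k D (indicator Y) (\<lambda>a b. indicator Z (a, b))} \<in> sets borel"
      using J fin by (intro borel_lp_unique_min) (rule finite_subset)
    ultimately have "D -` {D. lp_unique_min J k D (indicator Y) (\<lambda>a b. indicator Z (a, b))} \<inter> space M \<in> sets M"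
      by (rule measurable_sets)
    moreover have "{\<omega> \<in> space M. U J Y Z \<omega>} =
      D -` {D. lp_unique_min J k D (indicator Y) (\<lambda>a b. indicator Z (a, b))} \<inter> space M"
      by (auto simp: U_def D_def)
    ultimately show ?thesis by simp
  qed
  have "{\<omega> \<in> space M. lp_exact_recovery k (sbm_cluster c n \<omega>)} =
    (\<Union>J\<in>Pow I. \<Union>(Y, Z)\<in>{(Y, Z)\<in>Pow J \<times> Pow (J \<times> J). R J Y Z}.
       {\<omega> \<in> space M. Q J \<omega>} \<inter> {\<omega> \<in> space M. U J Y Z \<omega>})" (is "?A = ?B")
  proof (intro set_eqI iffI)
    fix \<omega> assume A: "\<omega> \<in> ?A"
    then obtain J where J: "J \<subseteq> I" "Q J \<omega>" using Q_ex by blast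
    then obtain Y Z where "Y \<in> Pow J" "Z \<in> Pow (J \<times> J)" "R J Y Z" "U J Y Z \<omega>"
      using Q_imp[OF J] A by blast
    then show "\<omega> \<in> ?B"
      using A J by (intro UN_I[of J] UN_I[of "(Y, Z)"]) auto
  next
    fix \<omega> assume "\<omega> \<in> ?B"
    then obtain J Y Z where J: "J \<subseteq> I" "Q J \<omega>"
      and YZ: "Y \<in> Pow J" "Z \<in> Pow (J \<times> J)" "R J Y Z" "U J Y Z \<omega>" and \<omega>: "\<omega> \<in> space M"
      by blast
    have "lp_exact_recovery k (sbm_cluster c n \<omega>)"
      unfolding Q_imp[OF J] using YZ by (intro bexI[of _ "(Y, Z)"]) auto
    then show "\<omega> \<in> ?A" using \<omega> by blast
  qed
  also have "\<dots> \<in> sets M"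
  proof (rule sets.finite_UN)
    fix J assume "J \<in> Pow I"
    then have J: "J \<subseteq> I" "finite J" using fin finite_subset by auto
    show "(\<Union>(Y, Z)\<in>{(Y, Z)\<in>Pow J \<times> Pow (J \<times> J). R J Y Z}.
       {\<omega> \<in> space M. Q J \<omega>} \<inter> {\<omega> \<in> space M. U J Y Z \<omega>}) \<in> sets M"
    proof (rule sets.finite_UN)
      have "{(Y, Z) \<in> Pow J \<times> Pow (J \<times> J). R J Y Z} \<subseteq> Pow J \<times> Pow (J \<times> J)" by auto
      then show "finite {(Y, Z) \<in> Pow J \<times> Pow (J \<times> J). R J Y Z}"
        by (rule finite_subset) (use J in simp)
      show "(case YZ of (Y, Z) \<Rightarrow> {\<omega> \<in> space M. Q J \<omega>} \<inter> {\<omega> \<in> space M. U J Y Z \<omega>}) \<in> sets M" for YZ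
        using Q_sets[OF J(1)] U_sets[OF J(1)] by (cases YZ) auto
    qed
  qed (use fin in simp)
  finally show ?thesis unfolding sbm .
qed

subsection \<open>Typical samples\<close>

text \<open>\<open>X\<close> is a net of the points of the balls that are not \<open>r\<close>-close to any center, and \<open>G i x\<close> stands
  for the expectation of the cone function at \<open>x\<close> over the \<open>i\<close>-th ball. The dual value
  \<open>\<alpha> i = (\<xi> + S i (m i)) / n\<close> makes the medoid \<open>m i\<close> tight; near the centers no cone is truncated, so
  there the dual constraint reads \<open>S i (m i) \<le> S i p\<close>.\<close>

lemma lp_exact_recovery_of_typical_sample:
  fixes c :: "nat \<Rightarrow> 'a::real_normed_vector" and \<omega> :: "nat \<times> nat \<Rightarrow> 'a"
  assumes n: "0 < n" and e: "0 < e" and r: "0 < r" "2 * r + e \<le> \<eta>" "e \<le> r"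
    and sep: "\<And>i j. i \<in> {1..k} \<Longrightarrow> j \<in> {1..k} \<Longrightarrow> i \<noteq> j \<Longrightarrow> 2 + 4 * \<eta> \<le> dist (c i) (c j)"
    and ball: "\<And>i l. i \<in> {1..k} \<Longrightarrow> l \<in> {1..n} \<Longrightarrow> norm (\<omega> (i, l)) \<le> 1"
    and near: "\<And>i. i \<in> {1..k} \<Longrightarrow> \<exists>l\<in>{1..n}. norm (\<omega> (i, l)) \<le> e"
    and mean: "\<And>i. i \<in> {1..k} \<Longrightarrow> \<bar>(\<Sum>l\<in>{1..n}. norm (\<omega> (i, l))) - n * M\<bar> \<le> n * e"
    and cone: "\<And>i x. i \<in> {1..k} \<Longrightarrow> x \<in> X \<Longrightarrow>
      (\<Sum>l\<in>{1..n}. max 0 (1 + \<eta> - dist x (c i + \<omega> (i, l)))) \<le> n * (G i x + e)"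
    and gap: "\<And>x. x \<in> X \<Longrightarrow> (\<Sum>i\<in>{1..k}. G i x) + 4 * k * e < 1 + \<eta> - M"
    and net: "\<And>p j. j \<in> {1..k} \<Longrightarrow> dist p (c j) \<le> 1 \<Longrightarrow> (\<And>i. i \<in> {1..k} \<Longrightarrow> r \<le> dist p (c i)) \<Longrightarrow>
      \<exists>x\<in>X. dist p x \<le> e"
    and distinct: "\<And>i l l'. i \<in> {1..k} \<Longrightarrow> l \<in> {1..n} \<Longrightarrow> l' \<in> {1..n} \<Longrightarrow> l \<noteq> l' \<Longrightarrow>
      (\<Sum>j\<in>{1..n}. dist (\<omega> (i, l)) (\<omega> (i, j))) \<noteq> (\<Sum>j\<in>{1..n}. dist (\<omega> (i, l')) (\<omega> (i, j)))"
  shows "lp_exact_recovery k (sbm_cluster c n \<omega>)"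
proof -
  define C where "C = sbm_cluster c n \<omega>"
  define x where "x i l = c i + \<omega> (i, l)" for i l
  define S where "S i p = (\<Sum>l\<in>{1..n}. dist p (x i l))" for i p
  have C: "C i = x i ` {1..n}" for i
    by (simp add: C_def sbm_cluster_def x_def)
  have x_c: "dist (x i l) (c i) = norm (\<omega> (i, l))" for i l
    by (simp add: x_def dist_norm)
  have S_x: "S i (x i l) = (\<Sum>j\<in>{1..n}. dist (\<omega> (i, l)) (\<omega> (i, j)))" for i l
    by (simp add: S_def x_def)
  have inj: "inj_on (x i) {1..n}" if "i \<in> {1..k}" for i
  proof (rule inj_onI, rule ccontr)
    fix l l' assume "l \<in> {1..n}" "l' \<in> {1..n}" "x i l = x i l'" "l \<noteq> l'"
    then show False using distinct[OF that, of l l'] by (simp add: x_def)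
  qed
  have sumC: "(\<Sum>q\<in>C i. f q) = (\<Sum>l\<in>{1..n}. f (x i l))" if "i \<in> {1..k}" for i and f :: "'a \<Rightarrow> real"
    unfolding C using inj[OF that] by (simp add: sum.reindex)
  have C_ball: "dist q (c i) \<le> 1" if "i \<in> {1..k}" "q \<in> C i" for i q
    using that ball x_c by (auto simp: C)
  have C_far: "1 + 4 * \<eta> \<le> dist q (c j)" if "i \<in> {1..k}" "j \<in> {1..k}" "i \<noteq> j" "q \<in> C i" for i j q
    using sep[OF that(1-3)] C_ball[OF that(1,4)] dist_triangle3[of "c i" "c j" q] by linarith
  have "\<exists>l. l \<in> {1..n} \<and> (\<forall>l'\<in>{1..n}. S i (x i l) \<le> S i (x i l'))" for i
  proof -
    obtain l where "is_arg_min (\<lambda>l. S i (x i l)) (\<lambda>l. l \<in> {1..n}) l"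
      using ex_is_arg_min_if_finite[of "{1..n}" "\<lambda>l. S i (x i l)"] n by auto
    then show ?thesis
      unfolding is_arg_min_linorder by blast
  qed
  then have "\<forall>i. \<exists>l. l \<in> {1..n} \<and> (\<forall>l'\<in>{1..n}. S i (x i l) \<le> S i (x i l'))" by blast
  from choice[OF this] obtain lm where
    lm: "\<And>i. lm i \<in> {1..n}" "\<And>i l. l \<in> {1..n} \<Longrightarrow> S i (x i (lm i)) \<le> S i (x i l)"
    by blast
  define m where "m i = x i (lm i)" for i
  have m: "m i \<in> C i" for i
    using lm(1) by (simp add: m_def C)
  have m_less: "S i (m i) < S i p" if i: "i \<in> {1..k}" and p: "p \<in> C i" "p \<noteq> m i" for i p
  proof -
    obtain l where l: "l \<in> {1..n}" "p = x i l" using p(1) unfolding C by blast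
    then have "l \<noteq> lm i" using p(2) by (auto simp: m_def)
    then show ?thesis
      using distinct[OF i l(1) lm(1)[of i]] lm(2)[OF l(1), of i] l(2)
      by (simp add: m_def S_x)
  qed
  define a where "a = 1 + \<eta>"
  \<comment> \<open>\<open>a - M\<close> is the value that the limiting dual function has at a
    center when \<open>M\<close> is the mean norm.\<close>
  define \<xi> where "\<xi> = n * (a - M)"
  define \<alpha> where "\<alpha> i = (\<xi> + S i (m i)) / n" for i
  have n_\<alpha>: "n * \<alpha> i = \<xi> + S i (m i)" for i
    using n by (simp add: \<alpha>_def)
  \<comment> \<open>A draw within \<open>e\<close> of the center competes with the medoid; its
    distance sum exceeds the sum of the norms by at most \<open>n * e\<close>, and the sampled norms
    deviate from their mean by another \<open>n * e\<close>.\<close>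
  have \<alpha>_le: "\<alpha> i \<le> a + 2 * e" if i: "i \<in> {1..k}" for i
  proof -
    obtain l where l: "l \<in> {1..n}" "norm (\<omega> (i, l)) \<le> e" using near[OF i] by blast
    have "S i (m i) \<le> S i (x i l)" using lm(2)[OF l(1)] by (simp add: m_def)
    also have "\<dots> \<le> (\<Sum>j\<in>{1..n}. e + norm (\<omega> (i, j)))"
      unfolding S_x using l(2) norm_triangle_ineq4[of "\<omega> (i, l)"]
      by (intro sum_mono) (simp add: dist_norm, smt (verit))
    also have "\<dots> = n * e + (\<Sum>j\<in>{1..n}. norm (\<omega> (i, j)))"
      by (simp add: sum.distrib)
    also have "\<dots> \<le> n * e + (n * M + n * e)"
      using mean[OF i] by linarith
    finally have "n * \<alpha> i \<le> n * (a + 2 * e)"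
      unfolding n_\<alpha> \<xi>_def by (simp add: algebra_simps)
    then show ?thesis using n by simp
  qed
  have tight: "(\<Sum>q\<in>C i. \<alpha> i - dist p q) = n * \<alpha> i - S i p" if "i \<in> {1..k}" for i p
    unfolding sumC[OF that] by (simp add: S_def sum_subtractf)
  have far: "(\<Sum>i\<in>{1..k}. \<Sum>q\<in>C i. max 0 (\<alpha> i - dist p q)) < \<xi>"
    if p: "j \<in> {1..k}" "p \<in> C j" "\<And>i. i \<in> {1..k} \<Longrightarrow> r \<le> dist p (c i)" for p j
  proof -
    obtain y where y: "y \<in> X" "dist p y \<le> e"
      using net[OF p(1) C_ball[OF p(1,2)] p(3)] by blast
    \<comment> \<open>The error of \<open>4 * e\<close> per cluster, matched by \<open>gap\<close>,
      consists of \<open>2 * e\<close> from \<open>\<alpha> i\<close>, \<open>e\<close> from passing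
      to the net point and \<open>e\<close> from the sample mean.\<close>
    have "(\<Sum>q\<in>C i. max 0 (\<alpha> i - dist p q)) \<le> n * (G i y + 4 * e)" if i: "i \<in> {1..k}" for i
    proof -
      have "(\<Sum>q\<in>C i. max 0 (\<alpha> i - dist p q)) \<le>
        (\<Sum>l\<in>{1..n}. max 0 (1 + \<eta> - dist y (c i + \<omega> (i, l))) + 3 * e)"
        unfolding sumC[OF i]
      proof (rule sum_mono)
        fix l
        show "max 0 (\<alpha> i - dist p (x i l)) \<le> max 0 (1 + \<eta> - dist y (c i + \<omega> (i, l))) + 3 * e"
          using \<alpha>_le[OF i] y(2) e dist_triangle3[of y "x i l" p] by (simp add: x_def a_def max_def)
      qed
      also have "\<dots> \<le> n * (G i y + e) + n * (3 * e)"
        using cone[OF i y(1)] by (simp add: sum.distrib)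
      finally show ?thesis by (simp add: algebra_simps)
    qed
    then have "(\<Sum>i\<in>{1..k}. \<Sum>q\<in>C i. max 0 (\<alpha> i - dist p q)) \<le> (\<Sum>i\<in>{1..k}. n * (G i y + 4 * e))"
      by (rule sum_mono)
    also have "\<dots> = n * ((\<Sum>i\<in>{1..k}. G i y) + 4 * k * e)"
      by (simp add: sum.distrib flip: sum_distrib_left)
    also have "\<dots> < \<xi>"
      using gap[OF y(1)] n by (simp add: \<xi>_def a_def)
    finally show ?thesis .
  qed
  have near_own: "i = j" if "i \<in> {1..k}" "j \<in> {1..k}" "p \<in> C i" "dist p (c j) < r" for i j p
  proof (rule ccontr)
    assume "i \<noteq> j"
    from C_far[OF that(1,2) this that(3)] that(4) r e show False by linarith
  qed
  \<comment> \<open>By the choice of \<open>\<alpha> i\<close> the dual function is at least \<xi>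
    at the medoid, while it stays below \<xi> at points away from all centers.\<close>
  have m_near: "dist (m i) (c i) < r" if i: "i \<in> {1..k}" for i
  proof (rule ccontr)
    assume *: "\<not> dist (m i) (c i) < r"
    have "r \<le> dist (m i) (c j)" if "j \<in> {1..k}" for j
      using near_own[OF i that m] * by (cases "i = j") force+
    then have less: "(\<Sum>j\<in>{1..k}. \<Sum>q\<in>C j. max 0 (\<alpha> j - dist (m i) q)) < \<xi>"
      using far[OF i m] by blast
    have "\<xi> = (\<Sum>q\<in>C i. \<alpha> i - dist (m i) q)"
      using tight[OF i] n_\<alpha> by simp
    also have "\<dots> \<le> (\<Sum>q\<in>C i. max 0 (\<alpha> i - dist (m i) q))"
      by (intro sum_mono) simp
    also have "\<dots> \<le> (\<Sum>j\<in>{1..k}. \<Sum>q\<in>C j. max 0 (\<alpha> j - dist (m i) q))"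
      by (rule member_le_sum[OF i]) (auto intro!: sum_nonneg)
    finally show False using less by simp
  qed
  have \<alpha>_ge: "a - r - e \<le> \<alpha> i" if i: "i \<in> {1..k}" for i
  proof -
    have "(\<Sum>l\<in>{1..n}. norm (\<omega> (i, l)) - r) \<le> S i (m i)"
      unfolding S_def
    proof (rule sum_mono)
      fix l
      show "norm (\<omega> (i, l)) - r \<le> dist (m i) (x i l)"
        using m_near[OF i] dist_triangle3[of "x i l" "c i" "m i"] x_c[of i l] by linarith
    qed
    then have "n * M - n * e - n * r \<le> S i (m i)"
      using mean[OF i] by (simp add: sum_subtractf)
    then have "n * (a - r - e) \<le> n * \<alpha> i"
      unfolding n_\<alpha> \<xi>_def by (simp add: algebra_simps)
    then show ?thesis using n by simp
  qed
  \<comment> \<open>\<open>2 * r + e \<le> \<eta>\<close> gives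
    \<open>1 + r \<le> a - r - e \<le> \<alpha> i\<close>, so the cones of the own cluster are not
    truncated. In the next claim, \<open>a + 2 * e \<le> 1 + 4 * \<eta> - r\<close> makes the cones
    of all other clusters vanish.\<close>
  have inside: "dist p q \<le> \<alpha> i" if "i \<in> {1..k}" "dist p (c i) < r" "q \<in> C i" for i p q
    using \<alpha>_ge[OF that(1)] C_ball[OF that(1,3)] that(2) dist_triangle2[of p q "c i"] r
    by (simp add: a_def)
  have outside: "\<alpha> i < dist p q" if "i \<in> {1..k}" "j \<in> {1..k}" "i \<noteq> j" "dist p (c j) < r" "q \<in> C i" for i j p q
    using \<alpha>_le[OF that(1)] C_far[OF that(1,2,3,5)] that(4) dist_triangle3[of q "c j" p] r e
    by (simp add: a_def)
  show ?thesis
    unfolding C_def[symmetric]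
  proof (rule lp_exact_recovery_certificate[of k C m \<alpha> \<xi>])
    show "finite (C i)" for i by (simp add: C)
    show "C i \<inter> C j = {}" if "i \<in> {1..k}" "j \<in> {1..k}" "i \<noteq> j" for i j
      using C_far[OF that] C_ball[OF that(2)] r e by force
    show "m i \<in> C i" for i by (rule m)
    show "dist (m i) q \<le> \<alpha> i" if "i \<in> {1..k}" "q \<in> C i" for i q
      using inside m_near that by blast
    show "\<alpha> i < dist (m j) q" if "i \<in> {1..k}" "j \<in> {1..k}" "i \<noteq> j" "q \<in> C i" for i j q
      using outside[OF that(1-3) m_near[OF that(2)] that(4)] .
    show "(\<Sum>q\<in>C i. \<alpha> i - dist (m i) q) = \<xi>" if "i \<in> {1..k}" for i
      using tight[OF that] n_\<alpha> by simp
    fix p assume p: "p \<in> (\<Union>i\<in>{1..k}. C i)" "p \<notin> m ` {1..k}"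
    then obtain j where j: "j \<in> {1..k}" "p \<in> C j" by blast
    show "(\<Sum>i\<in>{1..k}. \<Sum>q\<in>C i. max 0 (\<alpha> i - dist p q)) < \<xi>"
    proof (cases "\<forall>i\<in>{1..k}. r \<le> dist p (c i)")
      case True
      then show ?thesis using far[OF j] by blast
    next
      case False
      then have p_near: "dist p (c j) < r"
        using near_own[OF j(1) _ j(2)] by force
      have "(\<Sum>i\<in>{1..k}. \<Sum>q\<in>C i. max 0 (\<alpha> i - dist p q)) =
        (\<Sum>i\<in>{1..k}. if i = j then n * \<alpha> j - S j p else 0)"
      proof (intro sum.cong refl)
        fix i assume i: "i \<in> {1..k}"
        show "(\<Sum>q\<in>C i. max 0 (\<alpha> i - dist p q)) = (if i = j then n * \<alpha> j - S j p else 0)"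
        proof (cases "i = j")
          case True
          have "(\<Sum>q\<in>C i. max 0 (\<alpha> i - dist p q)) = (\<Sum>q\<in>C i. \<alpha> i - dist p q)"
            using inside[OF j(1) p_near] True by (intro sum.cong) auto
          then show ?thesis using tight[OF i] True by simp
        next
          case False
          have "(\<Sum>q\<in>C i. max 0 (\<alpha> i - dist p q)) = (\<Sum>q\<in>C i. 0)"
            using outside[OF i j(1) False p_near] by (intro sum.cong refl) (force simp: max_def)
          then show ?thesis using False by simp
        qed
      qed
      also have "\<dots> = n * \<alpha> j - S j p"
        using j by simp
      also have "\<dots> < \<xi>"
      proof -
        have "p \<noteq> m j" using p(2) j(1) by blast
        then show ?thesis
          unfolding n_\<alpha> using m_less[OF j] by simp
      qed
      finally show ?thesis .
    qed
  qed
qed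

text \<open>Hoeffding's inequality for the draws of ball \<open>i\<close>, with values in an
  interval of length \<open>2 * B'\<close>, bounds the probability by
  \<open>2 * exp (- n * e * e / (2 * B' * B'))\<close>.\<close>

lemma sbm_average_concentration:
  fixes \<mu> :: "'a measure" and g :: "'a \<Rightarrow> real" and e :: real
  assumes \<mu>: "prob_space \<mu>" and g[measurable]: "g \<in> borel_measurable \<mu>"
    and B: "\<And>v. v \<in> space \<mu> \<Longrightarrow> \<bar>g v\<bar> \<le> B" and i: "i \<in> {1..k}" and e: "0 < e"
  shows "(\<lambda>n. measure (sbm \<mu> k n) {\<omega> \<in> space (sbm \<mu> k n).
    n * e \<le> \<bar>(\<Sum>l\<in>{1..n}. g (\<omega> (i, l))) - n * (\<integral>v. g v \<partial>\<mu>)\<bar>}) \<longlonglongrightarrow> 0"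
proof -
  interpret \<mu>: prob_space \<mu> by fact
  \<comment> \<open>Hoeffding's bound divides by the squared length of the interval, so the bound is
    made positive.\<close>
  define B' where "B' = max B 1"
  have B': "\<bar>g v\<bar> \<le> B'" if "v \<in> space \<mu>" for v
    using B[OF that] by (simp add: B'_def)
  have B'_pos: "0 < B'" by (simp add: B'_def)
  define bad where "bad n = {\<omega> \<in> space (sbm \<mu> k n).
    n * e \<le> \<bar>(\<Sum>l\<in>{1..n}. g (\<omega> (i, l))) - n * (\<integral>v. g v \<partial>\<mu>)\<bar>}" for n
  have bound: "measure (sbm \<mu> k n) (bad n) \<le> 2 * exp (- (e\<^sup>2 / (2 * B'\<^sup>2)) * n)" if n: "0 < n" for n
  proof -
    define I where "I = {1..k} \<times> {1..n}"
    define M where "M = (\<Pi>\<^sub>M il\<in>I. \<mu>)"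
    have sbm: "sbm \<mu> k n = M" by (simp add: sbm_def M_def I_def)
    interpret M: prob_space M
      unfolding M_def by (intro prob_space_PiM \<mu>)
    define K where "K = {i} \<times> {1..n}"
    have K: "K \<subseteq> I" "finite K" "K \<noteq> {}"
      using i n by (auto simp: K_def I_def)
    have distr_M: "distr M \<mu> (\<lambda>\<omega>. \<omega> il) = \<mu>" if "il \<in> I" for il
      unfolding M_def using that by (intro distr_PiM_component \<mu>)
    have comp: "(\<lambda>\<omega>. \<omega> il) \<in> measurable M \<mu>" if "il \<in> I" for il
      using that by (simp add: M_def)
    \<comment> \<open>The coordinates are independent because their joint law is the product measure
      itself.\<close>
    have "M.indep_vars (\<lambda>_. \<mu>) (\<lambda>il \<omega>. \<omega> il) I"
    proof (subst M.indep_vars_iff_distr_eq_PiM')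
      have "distr M (Pi\<^sub>M I (\<lambda>_. \<mu>)) (\<lambda>\<omega>. \<lambda>il\<in>I. \<omega> il) = distr M M (\<lambda>\<omega>. \<omega>)"
        by (intro distr_cong) (auto simp: M_def space_PiM PiE_iff extensional_restrict)
      also have "\<dots> = M" by (rule distr_id)
      also have "M = Pi\<^sub>M I (\<lambda>il. distr M \<mu> (\<lambda>\<omega>. \<omega> il))"
        unfolding M_def by (intro PiM_cong refl) (simp add: distr_M[unfolded M_def])
      finally show "distr M (Pi\<^sub>M I (\<lambda>_. \<mu>)) (\<lambda>\<omega>. \<lambda>il\<in>I. \<omega> il) = Pi\<^sub>M I (\<lambda>il. distr M \<mu> (\<lambda>\<omega>. \<omega> il))" .
    qed (use K comp in auto)
    then have "M.indep_vars (\<lambda>_. borel) (\<lambda>il \<omega>. g (\<omega> il)) I"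
      by (rule M.indep_vars_compose2) simp
    then have indep: "M.indep_vars (\<lambda>_. borel) (\<lambda>il \<omega>. g (\<omega> il)) K"
      using K(1) by (rule M.indep_vars_subset)
    define S where "S = (\<Sum>il\<in>K. M.expectation (\<lambda>\<omega>. g (\<omega> il)))"
    interpret H: Hoeffding_ineq M K "\<lambda>il \<omega>. g (\<omega> il)" "\<lambda>_. - B'" "\<lambda>_. B'" S
    proof unfold_locales
      fix il assume "il \<in> K"
      then have "il \<in> I" using K by auto
      have "g (\<omega> il) \<in> {- B'..B'}" if "\<omega> \<in> space M" for \<omega>
        using B'[OF measurable_space[OF comp[OF \<open>il \<in> I\<close>] that]] by (simp add: abs_le_iff)
      then show "AE \<omega> in M. g (\<omega> il) \<in> {- B'..B'}" by simp
    qed (use K indep S_def in auto)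
    have "M.expectation (\<lambda>\<omega>. g (\<omega> il)) = (\<integral>v. g v \<partial>\<mu>)" if "il \<in> K" for il
    proof -
      have il: "il \<in> I" using that K by auto
      show ?thesis
        using integral_distr[OF comp[OF il] g] distr_M[OF il] by simp
    qed
    then have S: "S = n * (\<integral>v. g v \<partial>\<mu>)"
      by (simp add: S_def K_def)
    have sumK: "(\<Sum>il\<in>K. f il) = (\<Sum>l\<in>{1..n}. f (i, l))" for f :: "nat \<times> nat \<Rightarrow> real"
    proof -
      have "K = Pair i ` {1..n}" by (auto simp: K_def)
      then show ?thesis by (simp add: sum.reindex inj_on_def)
    qed
    have sq: "(\<Sum>il\<in>K. (B' - - B')\<^sup>2) = n * (4 * B'\<^sup>2)"
      by (simp add: K_def power2_eq_square)
    have "measure M (bad n) \<le> 2 * exp (- 2 * (n * e)\<^sup>2 / (\<Sum>il\<in>K. (B' - - B')\<^sup>2))"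
      using H.Hoeffding_ineq_abs_ge[of "n * e"] e n B'_pos
      unfolding sq bad_def sbm S sumK by simp
    also have "- 2 * (n * e)\<^sup>2 / (\<Sum>il\<in>K. (B' - - B')\<^sup>2) = - (e\<^sup>2 / (2 * B'\<^sup>2)) * n"
      unfolding sq using n B'_pos by (simp add: field_simps power2_eq_square)
    finally show ?thesis by (simp add: sbm)
  qed
  have "(\<lambda>n. 2 * exp (- (e\<^sup>2 / (2 * B'\<^sup>2)) * real n)) \<longlonglongrightarrow> 2 * 0"
  proof (intro tendsto_mult tendsto_const)
    have "0 < e\<^sup>2 / (2 * B'\<^sup>2)" using e B'_pos by simp
    then have "filterlim (\<lambda>n. - (e\<^sup>2 / (2 * B'\<^sup>2)) * real n) at_bot sequentially"
      by (intro filterlim_tendsto_neg_mult_at_bot[OF tendsto_const] filterlim_real_sequentially) simp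
    then show "(\<lambda>n. exp (- (e\<^sup>2 / (2 * B'\<^sup>2)) * real n)) \<longlonglongrightarrow> 0"
      by (rule filterlim_compose[OF exp_at_bot])
  qed
  then have lim: "(\<lambda>n. 2 * exp (- (e\<^sup>2 / (2 * B'\<^sup>2)) * real n)) \<longlonglongrightarrow> 0" by simp
  have "(\<lambda>n. measure (sbm \<mu> k n) (bad n)) \<longlonglongrightarrow> 0"
  proof (rule tendsto_sandwich[OF _ _ tendsto_const lim])
    show "\<forall>\<^sub>F n in sequentially. measure (sbm \<mu> k n) (bad n) \<le> 2 * exp (- (e\<^sup>2 / (2 * B'\<^sup>2)) * real n)"
      by (rule eventually_mono[OF eventually_gt_at_top[of 0]]) (rule bound)
  qed simp
  then show ?thesis by (simp add: bad_def)
qed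

text \<open>Removing open balls around the centers leaves a compact set on which the strict
  inequality holds pointwise. The expected cones are 1-Lipschitz in the apex \<open>x\<close>, so
  their sum attains its maximum there and the gap becomes uniform.\<close>

lemma cone_expectation_gap:
  fixes \<mu> :: "'a::euclidean_space measure" and c :: "nat \<Rightarrow> 'a"
  assumes \<mu>: "unit_ball_prob \<mu>" and dens: "has_density_on_unit_ball \<mu> p"
    and decr: "\<And>x1 x2. x1 \<in> cball 0 1 \<Longrightarrow> x2 \<in> cball 0 1 \<Longrightarrow> norm x1 < norm x2 \<Longrightarrow> p x1 > p x2"
    and sep: "\<And>i j. i \<in> {1..k} \<Longrightarrow> j \<in> {1..k} \<Longrightarrow> i \<noteq> j \<Longrightarrow> d \<le> dist (c i) (c j)"
    and d: "2 * a < d" and a: "1 \<le> a" and r: "0 < r"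
    and K_def: "K = (\<Union>j\<in>{1..k}. cball (c j) 1) - (\<Union>j\<in>{1..k}. ball (c j) r)"
  shows "compact K" and "\<exists>\<gamma>>0. \<forall>x\<in>K.
    (\<Sum>i\<in>{1..k}. \<integral>v. max 0 (a - dist x (c i + v)) \<partial>\<mu>) + \<gamma> \<le> a - (\<integral>v. norm v \<partial>\<mu>)"
proof -
  interpret prob_space \<mu> using \<mu> by (simp add: unit_ball_prob_def)
  note space_\<mu> = space_unit_ball_prob[OF \<mu>]
  note [measurable] = measurable_unit_ball_prob[OF \<mu> measurable_ident_sets[OF refl]]
  show K: "compact K"
    unfolding K_def by (intro compact_diff compact_UN open_UN) auto
  define G where "G i x = (\<integral>v. max 0 (a - dist x (c i + v)) \<partial>\<mu>)" for i x
  have int: "integrable \<mu> (\<lambda>v. max 0 (a - dist x (c i + v)))" for i x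
    by (rule integrable_const_bound[of _ a]) (use a in auto)
  have int_norm: "integrable \<mu> (\<lambda>v. norm v)"
    by (rule integrable_const_bound[of _ 1]) (auto simp: space_\<mu>)
  have lip: "\<bar>G i x - G i y\<bar> \<le> dist x y" for i x y
  proof -
    have *: "G i x - G i y \<le> dist x y" for x y
    proof -
      have "G i x - G i y = (\<integral>v. max 0 (a - dist x (c i + v)) - max 0 (a - dist y (c i + v)) \<partial>\<mu>)"
        unfolding G_def by (rule Bochner_Integration.integral_diff[OF int int, symmetric])
      also have "\<dots> \<le> (\<integral>v. dist x y \<partial>\<mu>)"
      proof (rule integral_mono)
        fix v
        show "max 0 (a - dist x (c i + v)) - max 0 (a - dist y (c i + v)) \<le> dist x y"
          using dist_triangle3[of y "c i + v" x]
            by (simp add: max_def dist_commute) (use zero_le_dist[of x y] in arith)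
      qed (use int in auto)
      finally show ?thesis by (simp add: prob_space)
    qed
    show ?thesis using *[of x y] *[of y x] by (simp add: dist_commute)
  qed
  have cont: "continuous_on K (\<lambda>x. \<Sum>i\<in>{1..k}. G i x)"
  proof (intro continuous_on_sum)
    fix i
    show "continuous_on K (G i)"
      unfolding continuous_on_iff
    proof (intro ballI allI impI)
      fix x and e :: real assume "0 < e"
      then show "\<exists>d>0. \<forall>x'\<in>K. dist x' x < d \<longrightarrow> dist (G i x') (G i x) < e"
        using lip[of i] by (intro exI[of _ e]) (auto simp: dist_real_def intro: le_less_trans)
    qed
  qed
  have less: "(\<Sum>i\<in>{1..k}. G i x) < a - (\<integral>v. norm v \<partial>\<mu>)" if x: "x \<in> K" for x
  proof -
    have "x \<notin> c ` {1..k}"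
      using x r by (auto simp: K_def)
    then have "(\<integral>\<^sup>+v. (\<Sum>i\<in>{1..k}. ennreal (max 0 (a - dist x (c i + v)))) \<partial>\<mu>)
        < (\<integral>\<^sup>+v. ennreal (a - norm v) \<partial>\<mu>)"
      by (intro sum_cone_expectation_less[OF \<mu> dens, where d = d] decr sep d a) simp_all
    also have "(\<integral>\<^sup>+v. (\<Sum>i\<in>{1..k}. ennreal (max 0 (a - dist x (c i + v)))) \<partial>\<mu>)
        = (\<integral>\<^sup>+v. ennreal (\<Sum>i\<in>{1..k}. max 0 (a - dist x (c i + v))) \<partial>\<mu>)"
      by (intro nn_integral_cong sum_ennreal) simp
    also have "\<dots> = ennreal (\<integral>v. (\<Sum>i\<in>{1..k}. max 0 (a - dist x (c i + v))) \<partial>\<mu>)"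
      by (intro nn_integral_eq_integral) (auto intro!: int Bochner_Integration.integrable_sum sum_nonneg)
    also have "(\<integral>v. (\<Sum>i\<in>{1..k}. max 0 (a - dist x (c i + v))) \<partial>\<mu>) = (\<Sum>i\<in>{1..k}. G i x)"
      unfolding G_def by (intro Bochner_Integration.integral_sum int)
    also have "(\<integral>\<^sup>+v. ennreal (a - norm v) \<partial>\<mu>) = ennreal (\<integral>v. a - norm v \<partial>\<mu>)"
      using a by (intro nn_integral_eq_integral) (auto simp: space_\<mu> intro!: int_norm)
    also have "(\<integral>v. a - norm v \<partial>\<mu>) = a - (\<integral>v. norm v \<partial>\<mu>)"
      using int_norm by (simp add: prob_space)
    finally show ?thesis
      by (subst (asm) ennreal_less_iff) (auto intro!: sum_nonneg Bochner_Integration.integral_nonneg simp: G_def)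
  qed
  show "\<exists>\<gamma>>0. \<forall>x\<in>K. (\<Sum>i\<in>{1..k}. \<integral>v. max 0 (a - dist x (c i + v)) \<partial>\<mu>) + \<gamma>
      \<le> a - (\<integral>v. norm v \<partial>\<mu>)"
  proof (cases "K = {}")
    case True
    then show ?thesis by (intro exI[of _ 1]) auto
  next
    case False
    then obtain x0 where x0: "x0 \<in> K" "\<And>x. x \<in> K \<Longrightarrow> (\<Sum>i\<in>{1..k}. G i x) \<le> (\<Sum>i\<in>{1..k}. G i x0)"
      using continuous_attains_sup[OF K _ cont] by blast
    show ?thesis
      unfolding G_def[symmetric]
      using less[OF x0(1)] x0(2)
      by (intro exI[of _ "a - (\<integral>v. norm v \<partial>\<mu>) - (\<Sum>i\<in>{1..k}. G i x0)"]) fastforce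
  qed
qed

theorem theorem8:
  fixes \<mu> :: "(real ^ 'm) measure"
    and p :: "real ^ 'm \<Rightarrow> real"
    and c :: "nat \<Rightarrow> real ^ 'm"
    and k :: nat
  assumes "CARD('m) \<ge> 2"
    and "unit_ball_prob \<mu>"
    and "rotation_invariant \<mu>"
    and "charges_nhds_zero \<mu>"
    and "null_on_lebesgue_null \<mu>"
    and "has_density_on_unit_ball \<mu> p"
    and "\<And>x1 x2. x1 \<in> cball 0 1 \<Longrightarrow> x2 \<in> cball 0 1 \<Longrightarrow> norm x1 < norm x2 \<Longrightarrow> p x1 > p x2"
    and "\<And>i j. i \<in> {1..k} \<Longrightarrow> j \<in> {1..k} \<Longrightarrow> i \<noteq> j \<Longrightarrow> dist (c i) (c j) > 2"
  shows "with_high_probability (sbm \<mu> k) (\<lambda>n \<omega>. lp_exact_recovery k (sbm_cluster c n \<omega>))"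
proof -
  note \<mu> = assms(2) and dens = assms(6) and decr = assms(7) and sep2 = assms(8)
  interpret prob_space \<mu> using \<mu> by (simp add: unit_ball_prob_def)
  note space_\<mu> = space_unit_ball_prob[OF \<mu>]
  have test_meas:
    "(indicator (ball 0 s) :: real ^ 'm \<Rightarrow> real) \<in> borel_measurable \<mu>"
    "(norm :: real ^ 'm \<Rightarrow> real) \<in> borel_measurable \<mu>"
    "(\<lambda>v. max 0 (s - dist x (c i + v))) \<in> borel_measurable \<mu>" for s x i
    by (intro measurable_unit_ball_prob[OF \<mu>] borel_measurable_indicator borel_measurable_continuous_onI continuous_intros; simp)+
  obtain \<eta> where \<eta>: "0 < \<eta>"
    and sep: "\<And>i j. i \<in> {1..k} \<Longrightarrow> j \<in> {1..k} \<Longrightarrow> i \<noteq> j \<Longrightarrow> 2 + 4 * \<eta> \<le> dist (c i) (c j)"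
  proof -
    \<comment> \<open>The element 3 keeps the minimum defined and above 2 when
      \<open>k \<le> 1\<close> and there is no pair of centers.\<close>
    define D where "D = insert 3 ((\<lambda>(i, j). dist (c i) (c j)) ` {(i, j) \<in> {1..k} \<times> {1..k}. i \<noteq> j})"
    have "finite {(i, j) \<in> {1..k} \<times> {1..k}. i \<noteq> j}"
      by (rule finite_subset[of _ "{1..k} \<times> {1..k}"]) auto
    then have D: "finite D" "D \<noteq> {}" by (auto simp: D_def)
    have "2 < Min D"
      using D sep2 by (subst Min_gr_iff) (auto simp: D_def)
    moreover have "Min D \<le> dist (c i) (c j)" if "i \<in> {1..k}" "j \<in> {1..k}" "i \<noteq> j" for i j
      using D that by (intro Min_le) (auto simp: D_def)
    ultimately show ?thesis
      by (intro that[of "(Min D - 2) / 4"]) (auto simp: diff_divide_distrib)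
  qed
  define a where "a = 1 + \<eta>"
  \<comment> \<open>A quarter of \<eta> suffices: together with \<open>e \<le> r\<close> it gives
    \<open>2 * r + e \<le> \<eta>\<close>.\<close>
  define r where "r = \<eta> / 4"
  define M where "M = (\<integral>v. norm v \<partial>\<mu>)"
  define G where "G i x = (\<integral>v. max 0 (a - dist x (c i + v)) \<partial>\<mu>)" for i x
  define K where "K = (\<Union>j\<in>{1..k}. cball (c j) 1) - (\<Union>j\<in>{1..k}. ball (c j) r)"
  have a: "1 \<le> a" "2 * a < 2 + 4 * \<eta>" using \<eta> by (auto simp: a_def)
  have r: "0 < r" using \<eta> by (simp add: r_def)
  note K_gap = cone_expectation_gap[OF \<mu> dens decr sep a(2,1) r K_def, folded G_def M_def]
  have K: "compact K" by (rule K_gap(1))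
  obtain \<gamma> where \<gamma>: "0 < \<gamma>" "\<And>x. x \<in> K \<Longrightarrow> (\<Sum>i\<in>{1..k}. G i x) + \<gamma> \<le> a - M"
    using K_gap(2) by blast
  \<comment> \<open>One constant serves as mesh of the net, as tolerance for sample means and as
    distance of some draw from its center. The denominator makes \<open>4 * k * e\<close> less than
    \<gamma>, with \<open>k + 1\<close> to cover \<open>k = 0\<close>.\<close>
  define e where "e = min r (\<gamma> / (8 * (k + 1)))"
  have e: "0 < e" "e \<le> r" using r \<gamma>(1) by (auto simp: e_def)
  have "4 * k * e < \<gamma>"
  proof -
    have "4 * k * e \<le> 4 * k * (\<gamma> / (8 * (k + 1)))"
      by (intro mult_left_mono) (auto simp: e_def)
    also have "\<dots> < \<gamma>"
      using \<gamma>(1) by (simp add: field_simps add_pos_nonneg)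
    finally show ?thesis .
  qed
  obtain X where X: "X \<subseteq> K" "finite X" "K \<subseteq> (\<Union>x\<in>X. ball x e)"
    using compactE_image[OF K, of K "\<lambda>x. ball x e"] e(1) by force
  have gap: "(\<Sum>i\<in>{1..k}. G i x) + 4 * k * e < a - M" if "x \<in> X" for x
    using \<gamma>(2)[of x] X(1) that \<open>4 * k * e < \<gamma>\<close> by auto
  have net: "\<exists>x\<in>X. dist y x \<le> e"
    if "j \<in> {1..k}" "dist y (c j) \<le> 1" "\<And>i. i \<in> {1..k} \<Longrightarrow> r \<le> dist y (c i)" for y j
  proof -
    have "y \<in> K" using that unfolding K_def by (auto simp: dist_commute not_less)
    then obtain x where "x \<in> X" "dist x y < e" using X(3) by auto
    then show ?thesis by (intro bexI[of _ x]) (auto simp: dist_commute)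
  qed
  \<comment> \<open>If no draw of a ball falls within \<open>e\<close> of its center, the sample
    mean of the indicator is 0 and deviates from its expectation by \<open>q\<close>. Concentration
    with tolerance \<open>q\<close> therefore produces a draw near the center.\<close>
  define q where "q = measure \<mu> (ball 0 e \<inter> space \<mu>)"
  have q: "0 < q"
  proof -
    have "openin (top_of_set (cball 0 1)) (ball 0 e \<inter> cball (0 :: real ^ 'm) 1)"
      by (metis Int_commute open_ball openin_open_Int)
    then have "0 < emeasure \<mu> (ball 0 e \<inter> cball 0 1)"
      using assms(4) e(1) by (simp add: charges_nhds_zero_def)
    then show ?thesis
      by (simp add: q_def space_\<mu> emeasure_eq_measure)
  qed
  text \<open>\<open>(i, g, s) \<in> T\<close> demands that the mean of \<open>g\<close> over the \<open>i\<close>-th sample is within \<open>s\<close> of its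
    expectation.\<close>
  define T where "T = (\<lambda>i. (i, indicator (ball 0 e), q)) ` {1..k} \<union> (\<lambda>i. (i, norm, e)) ` {1..k} \<union>
    (\<Union>x\<in>X. (\<lambda>i. (i, \<lambda>v. max 0 (a - dist x (c i + v)), e)) ` {1..k})"
  define bad where "bad n = (\<lambda>(i, g :: real ^ 'm \<Rightarrow> real, s :: real). {\<omega> \<in> space (sbm \<mu> k n).
    n * s \<le> \<bar>(\<Sum>l\<in>{1..n}. g (\<omega> (i, l))) - n * (\<integral>v. g v \<partial>\<mu>)\<bar>})" for n
  have finT: "finite T" using X(2) by (simp add: T_def)
  have lim: "(\<lambda>n. measure (sbm \<mu> k n) (bad n t)) \<longlonglongrightarrow> 0" if t: "t \<in> T" for t
  proof -
    have conc: "(\<lambda>n. measure (sbm \<mu> k n) (bad n (i, g, s))) \<longlonglongrightarrow> 0"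
      if "g \<in> borel_measurable \<mu>" "\<And>v. v \<in> space \<mu> \<Longrightarrow> \<bar>g v\<bar> \<le> a" "i \<in> {1..k}" "0 < s" for i g s
      using sbm_average_concentration[OF prob_space_axioms that] by (simp add: bad_def)
    from t consider i where "i \<in> {1..k}" "t = (i, indicator (ball 0 e), q)"
      | i where "i \<in> {1..k}" "t = (i, norm, e)"
      | i x where "i \<in> {1..k}" "t = (i, \<lambda>v. max 0 (a - dist x (c i + v)), e)"
      unfolding T_def by (elim UnE UN_E imageE) blast+
    then show ?thesis
    proof cases
      case 1
      show ?thesis
        unfolding 1(2) using a(1) q 1(1) by (intro conc test_meas) (auto simp: indicator_def)
    next
      case 2
      show ?thesis
        unfolding 2(2) using a(1) e(1) 2(1) by (intro conc test_meas) (auto simp: space_\<mu>)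
    next
      case 3
      show ?thesis
        unfolding 3(2) using a(1) e(1) 3(1) by (intro conc test_meas) auto
    qed
  qed
  have sum_lim: "(\<lambda>n. \<Sum>t\<in>T. measure (sbm \<mu> k n) (bad n t)) \<longlonglongrightarrow> 0"
    using tendsto_sum[of T "\<lambda>t n. measure (sbm \<mu> k n) (bad n t)" "\<lambda>_. 0" sequentially] lim by simp
  have typical: "lp_exact_recovery k (sbm_cluster c n \<omega>)"
    if n: "0 < n" and \<omega>: "\<omega> \<in> space (sbm \<mu> k n)" and good: "\<And>t. t \<in> T \<Longrightarrow> \<omega> \<notin> bad n t"
      and distinct: "\<forall>i\<in>{1..k}. \<forall>l\<in>{1..n}. \<forall>l'\<in>{1..n}. l \<noteq> l' \<longrightarrow>
    (\<Sum>j\<in>{1..n}. dist (\<omega> (i, l)) (\<omega> (i, j))) \<noteq> (\<Sum>j\<in>{1..n}. dist (\<omega> (i, l')) (\<omega> (i, j)))"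
    for n \<omega>
  proof -
    have good': "\<bar>(\<Sum>l\<in>{1..n}. g (\<omega> (i, l))) - n * (\<integral>v. g v \<partial>\<mu>)\<bar> < n * s"
      if "(i, g, s) \<in> T" for i g and s :: real
      using good[OF that] \<omega> by (simp add: bad_def not_le)
    show ?thesis
    proof (rule lp_exact_recovery_of_typical_sample[where \<eta> = \<eta> and r = r and e = e and M = M
          and X = X and G = G])
      show "2 * r + e \<le> \<eta>" using e(2) \<eta> by (simp add: r_def)
      show "norm (\<omega> (i, l)) \<le> 1" if "i \<in> {1..k}" "l \<in> {1..n}" for i l
        using \<omega> that PiE_mem[of \<omega> "{1..k} \<times> {1..n}" "\<lambda>_. space \<mu>" "(i, l)"]
        by (simp add: sbm_def space_PiM space_\<mu>)
      show "\<exists>l\<in>{1..n}. norm (\<omega> (i, l)) \<le> e" if "i \<in> {1..k}" for i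
      proof (rule ccontr)
        assume "\<not> (\<exists>l\<in>{1..n}. norm (\<omega> (i, l)) \<le> e)"
        then have "(\<Sum>l\<in>{1..n}. indicator (ball 0 e) (\<omega> (i, l))) = (0::real)"
          by (intro sum.neutral) (force simp: indicator_def)
        moreover have "(i, indicator (ball 0 e), q) \<in> T" using that by (auto simp: T_def)
        moreover have "(\<integral>v. indicator (ball 0 e) v \<partial>\<mu>) = q"
          by (simp add: q_def)
        ultimately show False
          using good'[of i "indicator (ball 0 e)" q] q by simp
      qed
      show "\<bar>(\<Sum>l\<in>{1..n}. norm (\<omega> (i, l))) - n * M\<bar> \<le> n * e" if "i \<in> {1..k}" for i
        using good'[of i norm e] that by (auto simp: T_def M_def intro: less_imp_le)
      show "(\<Sum>l\<in>{1..n}. max 0 (1 + \<eta> - dist x (c i + \<omega> (i, l)))) \<le> n * (G i x + e)"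
        if "i \<in> {1..k}" "x \<in> X" for i x
      proof -
        have "(i, \<lambda>v. max 0 (a - dist x (c i + v)), e) \<in> T"
          unfolding T_def using that by blast
        from good'[OF this] show ?thesis
          by (simp add: G_def a_def algebra_simps abs_less_iff)
      qed
      show "(\<Sum>i\<in>{1..k}. G i x) + 4 * k * e < 1 + \<eta> - M" if "x \<in> X" for x
        using gap[OF that] by (simp add: a_def)
    qed (use n e r sep net distinct in auto)
  qed
  show ?thesis
    unfolding with_high_probability_def
  proof (intro allI impI)
    fix \<delta> :: real assume \<delta>: "0 < \<delta> \<and> \<delta> < 1"
    then obtain N where N: "\<And>n. n \<ge> N \<Longrightarrow> (\<Sum>t\<in>T. measure (sbm \<mu> k n) (bad n t)) < \<delta>"
      using order_tendstoD(2)[OF sum_lim, of \<delta>] by (auto simp: eventually_sequentially)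
    \<comment> \<open>The offset 3 secures \<open>3 \<le> n\<close>, which the almost sure
      uniqueness of the medoids requires.\<close>
    have "measure (sbm \<mu> k n) {\<omega> \<in> space (sbm \<mu> k n). lp_exact_recovery k (sbm_cluster c n \<omega>)} > 1 - \<delta>"
      if n: "n > N + 3" for n
    proof -
      let ?S = "sbm \<mu> k n"
      let ?R = "{\<omega> \<in> space ?S. lp_exact_recovery k (sbm_cluster c n \<omega>)}"
      interpret S: prob_space ?S
        unfolding sbm_def by (intro prob_space_PiM prob_space_axioms)
      have R: "?R \<in> sets ?S"
        by (rule sets_lp_exact_recovery_event[OF \<mu> sep2])
      have bad_sets: "bad n t \<in> sets ?S" if t: "t \<in> T" for t
      proof -
        have *: "bad n (i, g, s) \<in> sets ?S" if g: "g \<in> borel_measurable \<mu>" and i: "i \<in> {1..k}" for i g s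
        proof -
          have [measurable]: "(\<lambda>\<omega>. g (\<omega> (i, l))) \<in> borel_measurable ?S" if "l \<in> {1..n}" for l
            unfolding sbm_def
            by (rule measurable_compose[OF _ g], rule measurable_component_singleton)
              (use i that in simp)
          show ?thesis
            unfolding bad_def prod.case by measurable
        qed
        show ?thesis
          using t unfolding T_def by (elim UnE UN_E imageE) (auto intro!: * test_meas)
      qed
      have "AE \<omega> in ?S. \<forall>i\<in>{1..k}. \<forall>l\<in>{1..n}. \<forall>l'\<in>{1..n}. l \<noteq> l' \<longrightarrow>
        (\<Sum>j\<in>{1..n}. dist (\<omega> (i, l)) (\<omega> (i, j))) \<noteq> (\<Sum>j\<in>{1..n}. dist (\<omega> (i, l')) (\<omega> (i, j)))"
        by (rule AE_sbm_distinct_distance_sums[OF \<mu> assms(5)]) (use assms(1) n in simp_all)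
      then have "AE \<omega> in ?S. \<omega> \<in> space ?S - (\<Union>t\<in>T. bad n t) \<longrightarrow> \<omega> \<in> ?R"
      proof (rule eventually_mono, intro impI)
        fix \<omega>
        assume distinct: "\<forall>i\<in>{1..k}. \<forall>l\<in>{1..n}. \<forall>l'\<in>{1..n}. l \<noteq> l' \<longrightarrow>
          (\<Sum>j\<in>{1..n}. dist (\<omega> (i, l)) (\<omega> (i, j))) \<noteq> (\<Sum>j\<in>{1..n}. dist (\<omega> (i, l')) (\<omega> (i, j)))"
          and \<omega>: "\<omega> \<in> space ?S - (\<Union>t\<in>T. bad n t)"
        have "lp_exact_recovery k (sbm_cluster c n \<omega>)"
          by (rule typical[OF _ _ _ distinct]) (use n \<omega> in auto)
        then show "\<omega> \<in> ?R" using \<omega> by blast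
      qed
      \<comment> \<open>The inclusion of the good event in \<open>?R\<close> holds only up to the
        null set of tied distance sums; comparing the measures across it uses the measurability
        \<open>R\<close>.\<close>
      then have "measure ?S (space ?S - (\<Union>t\<in>T. bad n t)) \<le> measure ?S ?R"
        using R by (rule S.finite_measure_mono_AE)
      moreover have "measure ?S (\<Union>t\<in>T. bad n t) \<le> (\<Sum>t\<in>T. measure ?S (bad n t))"
        using finT bad_sets by (intro S.finite_measure_subadditive_finite) auto
      moreover have "measure ?S (space ?S - (\<Union>t\<in>T. bad n t)) = 1 - measure ?S (\<Union>t\<in>T. bad n t)"
        using finT bad_sets by (intro S.prob_compl sets.finite_UN)
      ultimately show ?thesis
        using N[of n] n by simp
    qed
    then show "\<exists>N>0. \<forall>n>N. 1 - \<delta> < measure (sbm \<mu> k n)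
        {\<omega> \<in> space (sbm \<mu> k n). lp_exact_recovery k (sbm_cluster c n \<omega>)}"
      by (intro exI[of _ "N + 3"]) auto
  qed
qed

end
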